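(* Let $w\in H^\infty$, let $\varphi(z)=\lambda z$ where $\lambda$ is a primitive $k$th root of unity, and let $v\in H^\infty$ be defined by $$v(z)=w(z)\,w(\lambda z)\cdots w(\lambda^{k-1}z)\qquad (z\in\mathbb{D}).$$ Consider the weighted composition operator $T_{w,\varphi}$ on the Hardy space $H^2$. (i) If $\|v\|_\infty<1$, then $\|T_{w,\varphi}^n\|\to 0$ as $n\to\infty$. (ii) If $\|v\|_\infty>1$, then $T_{w,\varphi}^n$ does not converge weakly. (iii) If $\|v\|_\infty=1$ and $v$ is non-constant, then: (a) if $|v|<1$ a.e. on $\mathbb{T}$, then $T_{w,\varphi}^n\to 0$ strongly, although not uniformly; (b) if $|v|=1$ on a subset of $\mathbb{T}$ of positive measure, then $\|v^n\|_2\not\to 0$, and so $T_{w,\varphi}^n$ converges weakly to $0$ but does not converge strongly.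
   Context: $\mathbb{D}$ is the open unit disc, $\mathbb{T}$ the unit circle, $H^2$ and $H^\infty$ the Hardy spaces of the disc; $\|\cdot\|_2$ is the $H^2$ norm, and functions are identified with their boundary values a.e. on $\mathbb{T}$. The weighted composition operator is $(T_{w,\varphi}f)(z)=w(z)f(\varphi(z))$ for $f\in H^2$, $z\in\mathbb{D}$. Uniform convergence of $(T_{w,\varphi}^n)$ is convergence in operator norm; strong convergence is norm convergence of $T_{w,\varphi}^n f$ for every $f\in H^2$; weak convergence is weak convergence of $T_{w,\varphi}^n f$ for every $f\in H^2$. *)

theory Defs
  imports "HOL-Complex_Analysis.Complex_Analysis"
begin

definition primitive_root_of_unity :: "nat \<Rightarrow> complex \<Rightarrow> bool" where
  "primitive_root_of_unity k \<mu> \<longleftrightarrow> 0 < k \<and> \<mu> ^ k = 1 \<and> (\<forall>j. 0 < j \<and> j < k \<longrightarrow> \<mu> ^ j \<noteq> 1)"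


section \<open>Hardy spaces of the unit disc\<close>

text \<open>Functions on the disc are total functions on the complex plane; the notions below
  only depend on their values in the open unit disc.\<close>

definition H_inf :: "(complex \<Rightarrow> complex) set" where
  "H_inf = {f. f holomorphic_on ball 0 1 \<and> bounded (f ` ball 0 1)}"

definition H_inf_norm :: "(complex \<Rightarrow> complex) \<Rightarrow> real" where
  "H_inf_norm f = (SUP z\<in>ball 0 1. cmod (f z))"

definition sq_mean :: "(complex \<Rightarrow> complex) \<Rightarrow> real \<Rightarrow> real" where
  "sq_mean f r = integral {0..2*pi} (\<lambda>t. (cmod (f (of_real r * cis t)))\<^sup>2) / (2*pi)"

definition H2 :: "(complex \<Rightarrow> complex) set" where
  "H2 = {f. f holomorphic_on ball 0 1 \<and> bdd_above (sq_mean f ` {0..<1})}"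

definition H2_norm :: "(complex \<Rightarrow> complex) \<Rightarrow> real" where
  "H2_norm f = sqrt (SUP r\<in>{0..<1}. sq_mean f r)"

text \<open>Boundary values are radial limits. The value is unspecified where the radial limit
  does not exist; for functions in the Hardy spaces this is a null set, by Fatou's theorem.\<close>

definition boundary_value :: "(complex \<Rightarrow> complex) \<Rightarrow> complex \<Rightarrow> complex" where
  "boundary_value f \<zeta> = Lim (at_left (1::real)) (\<lambda>r. f (of_real r * \<zeta>))"


subsection \<open>Square means\<close>

lemma circle_in_ball: "0 \<le> r \<Longrightarrow> r < 1 \<Longrightarrow> of_real r * cis t \<in> ball (0::complex) 1"
  by (simp add: norm_mult)

lemma continuous_on_circle:
  assumes "f holomorphic_on ball 0 1" "0 \<le> r" "r < 1"
  shows "continuous_on A (\<lambda>t. f (of_real r * cis t))"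
proof -
  have "continuous_on (ball 0 1) f"
    using assms holomorphic_on_imp_continuous_on by blast
  then show ?thesis
    by (rule continuous_on_compose2) (use assms circle_in_ball in \<open>auto intro!: continuous_intros\<close>)
qed

lemma integrable_circle:
  assumes "f holomorphic_on ball 0 1" "0 \<le> r" "r < 1"
  shows "(\<lambda>t. (cmod (f (of_real r * cis t)))\<^sup>2) integrable_on {a..b}"
  by (intro integrable_continuous_real continuous_intros continuous_on_circle assms)

lemma sq_mean_nonneg: "0 \<le> sq_mean f r"
  unfolding sq_mean_def by (cases "(\<lambda>t. (cmod (f (of_real r * cis t)))\<^sup>2) integrable_on {0..2*pi}")
    (auto simp: integral_nonneg not_integrable_integral)

lemma sq_mean_cong:
  assumes "\<And>z. z \<in> ball 0 1 \<Longrightarrow> f z = g z" "0 \<le> r" "r < 1"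
  shows "sq_mean f r = sq_mean g r"
  using assms circle_in_ball unfolding sq_mean_def by simp

lemma sq_mean_le_H2_norm:
  assumes "f \<in> H2" "0 \<le> r" "r < 1"
  shows "sq_mean f r \<le> (H2_norm f)\<^sup>2"
proof -
  have le: "sq_mean f r \<le> (SUP r\<in>{0..<1}. sq_mean f r)"
    using assms by (intro cSUP_upper) (auto simp: H2_def)
  then have "0 \<le> (SUP r\<in>{0..<1}. sq_mean f r)"
    using sq_mean_nonneg order_trans by blast
  with le show ?thesis
    by (simp add: H2_norm_def)
qed

lemma H2_norm_le:
  assumes "\<And>r. 0 \<le> r \<Longrightarrow> r < 1 \<Longrightarrow> sq_mean f r \<le> C\<^sup>2" "0 \<le> C"
  shows "H2_norm f \<le> C"
proof -
  have "(SUP r\<in>{0..<1}. sq_mean f r) \<le> C\<^sup>2"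
    using assms by (intro cSUP_least) auto
  then have "H2_norm f \<le> sqrt (C\<^sup>2)"
    unfolding H2_norm_def by (rule real_sqrt_le_mono)
  then show ?thesis
    using assms by simp
qed

lemma H2I:
  assumes "f holomorphic_on ball 0 1" "\<And>r. 0 \<le> r \<Longrightarrow> r < 1 \<Longrightarrow> sq_mean f r \<le> C"
  shows "f \<in> H2"
  using assms unfolding H2_def by (auto intro!: bdd_aboveI2[where M=C])

lemma H2_holo: "f \<in> H2 \<Longrightarrow> f holomorphic_on ball 0 1"
  by (simp add: H2_def)

lemma H2_norm_nonneg:
  assumes "f \<in> H2"
  shows "0 \<le> H2_norm f"
proof -
  have "sq_mean f 0 \<le> (SUP r\<in>{0..<1}. sq_mean f r)"
    using assms by (intro cSUP_upper) (auto simp: H2_def)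
  then show ?thesis
    using sq_mean_nonneg[of f 0] by (simp add: H2_norm_def)
qed

lemma H2_norm_cong:
  assumes "\<And>z. z \<in> ball 0 1 \<Longrightarrow> f z = g z"
  shows "H2_norm f = H2_norm g"
proof -
  have "sq_mean f ` {0..<1} = sq_mean g ` {0..<1}"
    by (rule image_cong[OF refl]) (rule sq_mean_cong[OF assms], simp_all)
  then show ?thesis
    by (simp add: H2_norm_def)
qed

lemma sq_norm_add_le:
  fixes x y :: complex
  assumes "0 < a" "0 < b"
  shows "(cmod (x + y))\<^sup>2 \<le> (1 + b/a) * (cmod x)\<^sup>2 + (1 + a/b) * (cmod y)\<^sup>2"
proof -
  define s where "s = cmod x"
  define t where "t = cmod y"
  have "(cmod (x + y))\<^sup>2 \<le> (s + t)\<^sup>2"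
    unfolding s_def t_def by (intro power_mono norm_triangle_ineq) auto
  also have "(1 + b/a) * s\<^sup>2 + (1 + a/b) * t\<^sup>2 - (s + t)\<^sup>2 = (b * s - a * t)\<^sup>2 / (a*b)"
    using assms by (simp add: field_simps power2_eq_square)
  then have "(s + t)\<^sup>2 \<le> (1 + b/a) * s\<^sup>2 + (1 + a/b) * t\<^sup>2"
    using assms by (smt (verit) divide_nonneg_pos mult_pos_pos zero_le_power2)
  finally show ?thesis
    by (simp add: s_def t_def)
qed

lemma sq_mean_add_le:
  assumes f: "f holomorphic_on ball 0 1" and g: "g holomorphic_on ball 0 1"
    and r: "0 \<le> r" "r < 1" and ab: "0 < a" "0 < b"
    and "sq_mean f r \<le> a\<^sup>2" "sq_mean g r \<le> b\<^sup>2"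
  shows "sq_mean (\<lambda>z. f z + g z) r \<le> (a + b)\<^sup>2"
proof -
  let ?I = "\<lambda>h. integral {0..2*pi} (\<lambda>t. (cmod (h (of_real r * cis t)))\<^sup>2)"
  have int: "(\<lambda>t. c * (cmod (f (of_real r * cis t)))\<^sup>2) integrable_on {0..2*pi}"
      "(\<lambda>t. c * (cmod (g (of_real r * cis t)))\<^sup>2) integrable_on {0..2*pi}" for c :: real
    by (intro integrable_continuous_real continuous_intros continuous_on_circle f g r)+
  have "?I (\<lambda>z. f z + g z) \<le> integral {0..2*pi}
      (\<lambda>t. (1 + b/a) * (cmod (f (of_real r * cis t)))\<^sup>2 + (1 + a/b) * (cmod (g (of_real r * cis t)))\<^sup>2)"
    by (intro integral_le integrable_circle holomorphic_intros f g r integrable_add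
        int sq_norm_add_le ab)
  also have "\<dots> = (1 + b/a) * ?I f + (1 + a/b) * ?I g"
    by (subst Henstock_Kurzweil_Integration.integral_add)
      (rule int, rule int, simp)
  finally have "sq_mean (\<lambda>z. f z + g z) r \<le> (1 + b/a) * sq_mean f r + (1 + a/b) * sq_mean g r"
    by (simp add: sq_mean_def divide_right_mono add_divide_distrib[symmetric])
  also have "\<dots> \<le> (1 + b/a) * a\<^sup>2 + (1 + a/b) * b\<^sup>2"
    using assms by (intro add_mono mult_left_mono) auto
  also have "\<dots> = (a + b)\<^sup>2"
    using ab by (simp add: field_simps power2_eq_square)
  finally show ?thesis .
qed

lemma H2_add_aux:
  assumes f: "f \<in> H2" and g: "g \<in> H2"
    and r: "0 \<le> r" "r < 1" and "0 < e"
  shows "sq_mean (\<lambda>z. f z + g z) r \<le> (H2_norm f + H2_norm g + e)\<^sup>2"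
proof -
  have "sq_mean (\<lambda>z. f z + g z) r \<le> ((H2_norm f + e/2) + (H2_norm g + e/2))\<^sup>2"
  proof (rule sq_mean_add_le)
    show "sq_mean f r \<le> (H2_norm f + e/2)\<^sup>2"
      by (rule order_trans[OF sq_mean_le_H2_norm[OF f r]])
        (use H2_norm_nonneg[OF f] \<open>0 < e\<close> in \<open>auto intro!: power_mono\<close>)
    show "sq_mean g r \<le> (H2_norm g + e/2)\<^sup>2"
      by (rule order_trans[OF sq_mean_le_H2_norm[OF g r]])
        (use H2_norm_nonneg[OF g] \<open>0 < e\<close> in \<open>auto intro!: power_mono\<close>)
  qed (use assms H2_norm_nonneg[OF f] H2_norm_nonneg[OF g] H2_holo in auto)
  then show ?thesis
    by (simp add: algebra_simps)
qed

lemma H2_add: "f \<in> H2 \<Longrightarrow> g \<in> H2 \<Longrightarrow> (\<lambda>z. f z + g z) \<in> H2"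
  by (rule H2I[where C = "(H2_norm f + H2_norm g + 1)\<^sup>2"])
    ((intro holomorphic_on_add H2_holo; assumption), (rule H2_add_aux; simp))

lemma H2_norm_add:
  assumes "f \<in> H2" "g \<in> H2"
  shows "H2_norm (\<lambda>z. f z + g z) \<le> H2_norm f + H2_norm g"
proof (rule field_le_epsilon)
  fix e :: real assume "0 < e"
  then show "H2_norm (\<lambda>z. f z + g z) \<le> H2_norm f + H2_norm g + e"
    using assms by (intro H2_norm_le H2_add_aux) (auto simp: H2_norm_nonneg)
qed

lemma sq_mean_cmult: "sq_mean (\<lambda>z. c * f z) r = (cmod c)\<^sup>2 * sq_mean f r"
  by (simp add: sq_mean_def norm_mult power_mult_distrib)

lemma H2_cmult:
  assumes "f \<in> H2"
  shows "(\<lambda>z. c * f z) \<in> H2"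
proof (rule H2I[where C = "(cmod c)\<^sup>2 * (H2_norm f)\<^sup>2"])
  show "(\<lambda>z. c * f z) holomorphic_on ball 0 1"
    by (intro holomorphic_intros H2_holo assms)
qed (use assms sq_mean_le_H2_norm in \<open>auto simp: sq_mean_cmult mult_left_mono\<close>)

lemma H2_norm_cmult_le:
  assumes "f \<in> H2"
  shows "H2_norm (\<lambda>z. c * f z) \<le> cmod c * H2_norm f"
  using assms by (intro H2_norm_le)
    (auto simp: sq_mean_cmult power_mult_distrib H2_norm_nonneg sq_mean_le_H2_norm mult_left_mono)

lemma H2_norm_cmult:
  assumes "f \<in> H2"
  shows "H2_norm (\<lambda>z. c * f z) = cmod c * H2_norm f"
proof (cases "c = 0")
  case True
  then show ?thesis
    using H2_norm_cmult_le[OF assms, of 0] H2_norm_nonneg[OF H2_cmult[OF assms, of 0]] by simp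
next
  case False
  have "H2_norm (\<lambda>z. inverse c * (c * f z)) \<le> cmod (inverse c) * H2_norm (\<lambda>z. c * f z)"
    by (intro H2_norm_cmult_le H2_cmult assms)
  then have "cmod c * H2_norm f \<le> H2_norm (\<lambda>z. c * f z)"
    using False by (simp add: mult.assoc[symmetric] norm_inverse norm_divide field_simps)
  then show ?thesis
    using H2_norm_cmult_le[OF assms, of c] by simp
qed

lemma H2_zero: "(\<lambda>z. 0) \<in> H2"
  by (rule H2I[where C = 0]) (auto simp: sq_mean_def)

lemma H2_norm_zeroD:
  assumes f: "f \<in> H2" and "H2_norm f = 0" and z: "z \<in> ball 0 1"
  shows "f z = 0"
proof -
  define r where "r = cmod z"
  have r: "0 \<le> r" "r < 1"
    using z by (auto simp: r_def)
  let ?F = "\<lambda>t. (cmod (f (of_real r * cis t)))\<^sup>2"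
  have "sq_mean f r = 0"
    using sq_mean_le_H2_norm[OF f r] sq_mean_nonneg[of f r] assms by simp
  then have "integral {0..2*pi} ?F = 0"
    by (simp add: sq_mean_def)
  then have "(?F has_integral 0) (cbox 0 (2*pi))"
    using integrable_circle[OF H2_holo[OF f] r, of 0 "2*pi"] by (metis box_real(2) has_integral_integral)
  moreover have "continuous_on (cbox 0 (2*pi)) ?F"
    by (intro continuous_intros continuous_on_circle H2_holo f r)
  moreover have "Arg2pi z \<in> cbox 0 (2*pi)"
    using Arg2pi_ge_0[of z] Arg2pi_lt_2pi[of z] by simp
  moreover have "box 0 (2*pi) \<noteq> {}"
    using pi_gt_zero by (simp add: not_le)
  ultimately have "?F (Arg2pi z) = 0"
    by (intro has_integral_0_cbox_imp_0[of 0 "2*pi" ?F]) simp_all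
  moreover have "of_real r * cis (Arg2pi z) = z"
    unfolding r_def cis_conv_exp by (rule Arg2pi_eq[symmetric])
  ultimately show ?thesis
    by simp
qed


section \<open>The Hardy space as a normed space\<close>

text \<open>An element of the space is represented by the function that vanishes off the disc.\<close>

typedef hardy2 = "{f \<in> H2. \<forall>z. z \<notin> ball 0 1 \<longrightarrow> f z = 0}"
  morphisms hardy2_fun Abs_hardy2
  using H2_zero by auto

setup_lifting type_definition_hardy2

definition to_hardy2 :: "(complex \<Rightarrow> complex) \<Rightarrow> hardy2" where
  "to_hardy2 f = Abs_hardy2 (\<lambda>z. if z \<in> ball 0 1 then f z else 0)"

lemma H2_cong:
  assumes "\<And>z. z \<in> ball 0 1 \<Longrightarrow> f z = g z"
  shows "f \<in> H2 \<longleftrightarrow> g \<in> H2"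
proof -
  have "sq_mean f ` {0..<1} = sq_mean g ` {0..<1}"
    by (rule image_cong[OF refl]) (rule sq_mean_cong[OF assms], simp_all)
  moreover have "f holomorphic_on ball 0 1 \<longleftrightarrow> g holomorphic_on ball 0 1"
    using assms by (intro holomorphic_cong) auto
  ultimately show ?thesis
    by (simp add: H2_def)
qed

lemma hardy2_fun_to_hardy2:
  assumes "f \<in> H2" "z \<in> ball 0 1"
  shows "hardy2_fun (to_hardy2 f) z = f z"
proof -
  have "(\<lambda>z. if z \<in> ball 0 1 then f z else 0) \<in> H2"
    using assms(1) by (subst H2_cong[where g = f]) auto
  then have "(\<lambda>z. if z \<in> ball 0 1 then f z else 0) \<in> {f \<in> H2. \<forall>z. z \<notin> ball 0 1 \<longrightarrow> f z = 0}"
    by auto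
  then show ?thesis
    unfolding to_hardy2_def by (subst Abs_hardy2_inverse) (use assms in auto)
qed

lemma hardy2_fun_H2: "hardy2_fun f \<in> H2"
  using hardy2_fun[of f] by blast

lemma hardy2_eqI:
  assumes "\<And>z. z \<in> ball 0 1 \<Longrightarrow> hardy2_fun f z = hardy2_fun g z"
  shows "f = g"
proof -
  have "hardy2_fun f z = hardy2_fun g z" for z
  proof (cases "z \<in> ball 0 1")
    case False
    then have "hardy2_fun f z = 0" "hardy2_fun g z = 0"
      using hardy2_fun[of f] hardy2_fun[of g] by blast+
    then show ?thesis by simp
  qed (rule assms)
  then show ?thesis
    by (intro hardy2_fun_inject[THEN iffD1] ext)
qed

lift_definition cscale :: "complex \<Rightarrow> hardy2 \<Rightarrow> hardy2" is "\<lambda>c f z. c * f z"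
  by (simp add: H2_cmult)

instantiation hardy2 :: real_normed_vector
begin

lift_definition zero_hardy2 :: hardy2 is "\<lambda>z. 0"
  by (simp add: H2_zero)

lift_definition plus_hardy2 :: "hardy2 \<Rightarrow> hardy2 \<Rightarrow> hardy2" is "\<lambda>f g z. f z + g z"
  by (simp add: H2_add)

definition uminus_hardy2 :: "hardy2 \<Rightarrow> hardy2" where
  "uminus_hardy2 f = cscale (-1) f"

definition minus_hardy2 :: "hardy2 \<Rightarrow> hardy2 \<Rightarrow> hardy2" where
  "minus_hardy2 f g = f + (- g)"

definition scaleR_hardy2 :: "real \<Rightarrow> hardy2 \<Rightarrow> hardy2" where
  "scaleR_hardy2 a f = cscale (of_real a) f"

definition norm_hardy2 :: "hardy2 \<Rightarrow> real" where
  "norm_hardy2 f = H2_norm (hardy2_fun f)"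

definition dist_hardy2 :: "hardy2 \<Rightarrow> hardy2 \<Rightarrow> real" where
  "dist_hardy2 f g = norm (f - g)"

definition sgn_hardy2 :: "hardy2 \<Rightarrow> hardy2" where
  "sgn_hardy2 f = inverse (norm f) *\<^sub>R f"

definition uniformity_hardy2 :: "(hardy2 \<times> hardy2) filter" where
  "uniformity_hardy2 = (INF e\<in>{0 <..}. principal {(x, y). dist x y < e})"

definition open_hardy2 :: "hardy2 set \<Rightarrow> bool" where
  "open_hardy2 U = (\<forall>x\<in>U. eventually (\<lambda>(x', y). x' = x \<longrightarrow> y \<in> U) uniformity)"

instance
proof
  fix x y z :: hardy2 and a b :: real
  show "x + y + z = x + (y + z)" by transfer (simp add: add.assoc)
  show "x + y = y + x" by transfer (simp add: add.commute)
  show "0 + x = x" by transfer simp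
  show "- x + x = 0" unfolding uminus_hardy2_def by transfer simp
  show "x - y = x + - y" by (rule minus_hardy2_def)
  show "a *\<^sub>R (x + y) = a *\<^sub>R x + a *\<^sub>R y"
    unfolding scaleR_hardy2_def by transfer (simp add: distrib_left)
  show "(a + b) *\<^sub>R x = a *\<^sub>R x + b *\<^sub>R x"
    unfolding scaleR_hardy2_def by transfer (simp add: distrib_right)
  show "a *\<^sub>R b *\<^sub>R x = (a * b) *\<^sub>R x"
    unfolding scaleR_hardy2_def by transfer (simp add: mult.assoc)
  show "1 *\<^sub>R x = x"
    unfolding scaleR_hardy2_def by transfer simp
  show "dist x y = norm (x - y)" by (rule dist_hardy2_def)
  show "sgn x = inverse (norm x) *\<^sub>R x" by (rule sgn_hardy2_def)
  show "(uniformity :: (hardy2 \<times> hardy2) filter) = (INF e\<in>{0 <..}. principal {(x, y). dist x y < e})"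
    by (rule uniformity_hardy2_def)
  show "open U = (\<forall>x\<in>U. \<forall>\<^sub>F (x', y) in uniformity. x' = x \<longrightarrow> y \<in> U)" for U :: "hardy2 set"
    by (rule open_hardy2_def)
  show "norm (x + y) \<le> norm x + norm y"
    unfolding norm_hardy2_def plus_hardy2.rep_eq by (intro H2_norm_add hardy2_fun_H2)
  show "norm (a *\<^sub>R x) = \<bar>a\<bar> * norm x"
    unfolding norm_hardy2_def scaleR_hardy2_def cscale.rep_eq
    by (subst H2_norm_cmult[OF hardy2_fun_H2]) simp
  show "norm x = 0 \<longleftrightarrow> x = 0"
  proof
    assume "norm x = 0"
    then show "x = 0"
      by (intro hardy2_eqI) (simp add: norm_hardy2_def H2_norm_zeroD hardy2_fun_H2 zero_hardy2.rep_eq)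
  next
    assume "x = 0"
    then show "norm x = 0"
      using H2_norm_cmult[OF H2_zero, of 0] by (simp add: norm_hardy2_def zero_hardy2.rep_eq)
  qed
qed

end


section \<open>Weighted composition operators\<close>

text \<open>Meaningful when the weighted composition with \<open>w\<close> and \<open>\<phi>\<close> maps the Hardy space to itself;
  this is shown below for bounded \<open>w\<close> and rotations \<open>\<phi>\<close>.\<close>

definition wcomp :: "(complex \<Rightarrow> complex) \<Rightarrow> (complex \<Rightarrow> complex) \<Rightarrow> hardy2 \<Rightarrow> hardy2" where
  "wcomp w \<phi> f = to_hardy2 (\<lambda>z. w z * hardy2_fun f (\<phi> z))"

lemma integral_rotate:
  fixes g :: "complex \<Rightarrow> real"
  assumes cont: "continuous_on UNIV (\<lambda>t. g (cis t))"
  shows "integral {0..2*pi} (\<lambda>t. g (cis (t + a))) = integral {0..2*pi} (\<lambda>t. g (cis t))"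
proof -
  have ii: "(\<lambda>t. g (cis t)) integrable_on {x..y}" for x y
    by (intro integrable_continuous_real continuous_on_subset[OF cont]) auto
  have per: "g (cis (t + 2*pi)) = g (cis t)" for t
    by (subst cis_mult[symmetric]) simp
  have shift: "integral {x..y} (\<lambda>t. g (cis (t + c))) = integral {x + c..y + c} (\<lambda>t. g (cis t))"
    for x y c
    using integral_shift[of x c y "\<lambda>t. g (cis t)"] continuous_on_subset[OF cont subset_UNIV]
    by (simp only: o_def)
  have shift2: "integral {x + 2*pi..y + 2*pi} (\<lambda>t. g (cis t)) = integral {x..y} (\<lambda>t. g (cis t))" for x y
    unfolding shift[symmetric] per ..
  define b where "b = Arg2pi (cis a)"
  have b01: "0 \<le> b" "b < 2*pi"
    unfolding b_def by (rule Arg2pi_ge_0, rule Arg2pi_lt_2pi)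
  have bc: "cis b = cis a"
    unfolding b_def using Arg2pi_eq[of "cis a", symmetric] by (simp only: cis_conv_exp[of "Arg2pi (cis a)"] norm_cis of_real_1 mult_1_left)
  have "cis (t + a) = cis (t + b)" for t
    unfolding cis_mult[symmetric] bc ..
  then have "integral {0..2*pi} (\<lambda>t. g (cis (t + a))) = integral {0..2*pi} (\<lambda>t. g (cis (t + b)))"
    by (simp only:)
  also have "\<dots> = integral {b..2*pi + b} (\<lambda>t. g (cis t))"
    unfolding shift by (simp only: add_0_left)
  also have "\<dots> = integral {b..2*pi} (\<lambda>t. g (cis t)) + integral {2*pi..2*pi + b} (\<lambda>t. g (cis t))"
    using b01 by (intro Henstock_Kurzweil_Integration.integral_combine[symmetric] ii) simp_all
  also have "integral {2*pi..2*pi + b} (\<lambda>t. g (cis t)) = integral {0..b} (\<lambda>t. g (cis t))"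
    using shift2[of 0 b] by (simp only: add.commute[of b] add_0_left)
  also have "integral {b..2*pi} (\<lambda>t. g (cis t)) + integral {0..b} (\<lambda>t. g (cis t)) =
      integral {0..2*pi} (\<lambda>t. g (cis t))"
    using Henstock_Kurzweil_Integration.integral_combine[of 0 b "2*pi" "\<lambda>t. g (cis t)", OF b01(1) less_imp_le[OF b01(2)] ii]
    by (simp only: add.commute)
  finally show ?thesis .
qed

lemma sq_mean_rotate:
  assumes f: "f holomorphic_on ball 0 1" and r: "0 \<le> r" "r < 1" and "cmod \<mu> = 1"
  shows "sq_mean (\<lambda>z. f (\<mu> * z)) r = sq_mean f r"
proof -
  obtain a where a: "\<mu> = cis a"
    using \<open>cmod \<mu> = 1\<close> by (metis rcis_cmod_Arg rcis_def mult_1 of_real_1)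
  have "integral {0..2*pi} (\<lambda>t. (cmod (f (of_real r * cis (t + a))))\<^sup>2) =
      integral {0..2*pi} (\<lambda>t. (cmod (f (of_real r * cis t)))\<^sup>2)"
    by (rule integral_rotate[where g = "\<lambda>\<zeta>. (cmod (f (of_real r * \<zeta>)))\<^sup>2"])
      (intro continuous_intros continuous_on_circle f r)
  then show ?thesis
    unfolding sq_mean_def a cis_mult[symmetric] by (simp only: mult_ac)
qed

lemma sq_mean_mult_le:
  assumes w: "w holomorphic_on ball 0 1" and "\<And>z. z \<in> ball 0 1 \<Longrightarrow> cmod (w z) \<le> C"
    and f: "f holomorphic_on ball 0 1" and r: "0 \<le> r" "r < 1"
  shows "sq_mean (\<lambda>z. w z * f z) r \<le> C\<^sup>2 * sq_mean f r"
proof -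
  have "integral {0..2*pi} (\<lambda>t. (cmod (w (of_real r * cis t) * f (of_real r * cis t)))\<^sup>2)
      \<le> integral {0..2*pi} (\<lambda>t. C\<^sup>2 * (cmod (f (of_real r * cis t)))\<^sup>2)"
  proof (rule integral_le)
    show "(\<lambda>t. (cmod (w (of_real r * cis t) * f (of_real r * cis t)))\<^sup>2) integrable_on {0..2*pi}"
      by (intro integrable_continuous_real continuous_intros continuous_on_circle w f r)
    show "(\<lambda>t. C\<^sup>2 * (cmod (f (of_real r * cis t)))\<^sup>2) integrable_on {0..2*pi}"
      by (intro integrable_continuous_real continuous_intros continuous_on_circle f r)
    show "(cmod (w (of_real r * cis t) * f (of_real r * cis t)))\<^sup>2
        \<le> C\<^sup>2 * (cmod (f (of_real r * cis t)))\<^sup>2" for t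
      unfolding norm_mult power_mult_distrib
      by (intro mult_right_mono power_mono assms circle_in_ball r) auto
  qed
  then show ?thesis
    by (simp add: sq_mean_def divide_right_mono)
qed

context
  fixes w :: "complex \<Rightarrow> complex" and \<mu> :: complex
  assumes w: "w \<in> H_inf" and mu: "cmod \<mu> = 1"
begin

lemma wcomp_rotation_bound: "\<exists>C\<ge>0. \<forall>z\<in>ball 0 1. cmod (w z) \<le> C"
proof -
  obtain C where C: "\<forall>x\<in>w ` ball 0 1. norm x \<le> C"
    using w unfolding H_inf_def bounded_iff by blast
  then have "cmod (w 0) \<le> C"
    by simp
  then have "0 \<le> C"
    using norm_ge_zero order_trans by blast
  with C show ?thesis
    by (intro exI[of _ C]) simp
qed

lemma wcomp_rotation_aux:
  assumes f: "f \<in> H2" and C: "\<And>z. z \<in> ball 0 1 \<Longrightarrow> cmod (w z) \<le> C" and r: "0 \<le> r" "r < 1"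
  shows "(\<lambda>z. w z * f (\<mu> * z)) holomorphic_on ball 0 1"
    and "sq_mean (\<lambda>z. w z * f (\<mu> * z)) r \<le> C\<^sup>2 * (H2_norm f)\<^sup>2"
proof -
  have w': "w holomorphic_on ball 0 1"
    using w by (simp add: H_inf_def)
  have f': "(\<lambda>z. f (\<mu> * z)) holomorphic_on ball 0 1"
  proof (rule holomorphic_on_compose_gen[OF _ H2_holo[OF f], unfolded o_def])
    show "(\<lambda>z. \<mu> * z) ` ball 0 1 \<subseteq> ball 0 1"
      by (auto simp: norm_mult mu)
  qed (intro holomorphic_intros)
  show "(\<lambda>z. w z * f (\<mu> * z)) holomorphic_on ball 0 1"
    by (intro holomorphic_intros w' f')
  have "sq_mean (\<lambda>z. w z * f (\<mu> * z)) r \<le> C\<^sup>2 * sq_mean (\<lambda>z. f (\<mu> * z)) r"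
    by (rule sq_mean_mult_le[OF w' C f' r])
  also have "\<dots> = C\<^sup>2 * sq_mean f r"
    using sq_mean_rotate[OF H2_holo[OF f] r mu] by simp
  also have "\<dots> \<le> C\<^sup>2 * (H2_norm f)\<^sup>2"
    by (intro mult_left_mono sq_mean_le_H2_norm f r) auto
  finally show "sq_mean (\<lambda>z. w z * f (\<mu> * z)) r \<le> C\<^sup>2 * (H2_norm f)\<^sup>2" .
qed

lemma wcomp_rotation_H2:
  assumes "f \<in> H2"
  shows "(\<lambda>z. w z * f (\<mu> * z)) \<in> H2"
proof -
  obtain C where "0 \<le> C" "\<And>z. z \<in> ball 0 1 \<Longrightarrow> cmod (w z) \<le> C"
    using wcomp_rotation_bound by blast
  then show ?thesis
    using wcomp_rotation_aux[OF assms, of C] wcomp_rotation_aux(1)[OF assms, of C 0]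
    by (intro H2I) simp_all
qed

lemma hardy2_fun_wcomp:
  assumes "z \<in> ball 0 1"
  shows "hardy2_fun (wcomp w (\<lambda>z. \<mu> * z) f) z = w z * hardy2_fun f (\<mu> * z)"
  unfolding wcomp_def by (intro hardy2_fun_to_hardy2 wcomp_rotation_H2 hardy2_fun_H2 assms)

lemma bounded_linear_wcomp: "bounded_linear (wcomp w (\<lambda>z. \<mu> * z))"
proof -
  obtain C where C: "0 \<le> C" "\<And>z. z \<in> ball 0 1 \<Longrightarrow> cmod (w z) \<le> C"
    using wcomp_rotation_bound by blast
  show ?thesis
  proof (rule bounded_linear_intro[where K = C])
    fix f g and a :: real
    show "wcomp w (\<lambda>z. \<mu> * z) (f + g) = wcomp w (\<lambda>z. \<mu> * z) f + wcomp w (\<lambda>z. \<mu> * z) g"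
      by (rule hardy2_eqI) (simp only: hardy2_fun_wcomp plus_hardy2.rep_eq distrib_left)
    show "wcomp w (\<lambda>z. \<mu> * z) (a *\<^sub>R f) = a *\<^sub>R wcomp w (\<lambda>z. \<mu> * z) f"
      by (rule hardy2_eqI) (simp only: hardy2_fun_wcomp scaleR_hardy2_def cscale.rep_eq mult.left_commute)
    have "norm (wcomp w (\<lambda>z. \<mu> * z) f) = H2_norm (\<lambda>z. w z * hardy2_fun f (\<mu> * z))"
      unfolding norm_hardy2_def by (rule H2_norm_cong) (rule hardy2_fun_wcomp)
    also have "\<dots> \<le> C * norm f"
      using C wcomp_rotation_aux(2)[OF hardy2_fun_H2 C(2)]
      by (intro H2_norm_le) (auto simp: norm_hardy2_def power_mult_distrib hardy2_fun_H2 H2_norm_nonneg)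
    finally show "norm (wcomp w (\<lambda>z. \<mu> * z) f) \<le> norm f * C"
      by (simp add: mult.commute)
  qed
qed

end


section \<open>Convergence of sequences of operators\<close>

definition hardy2_dual :: "(hardy2 \<Rightarrow> complex) set" where
  "hardy2_dual = {\<psi>. bounded_linear \<psi> \<and> (\<forall>c f. \<psi> (cscale c f) = c * \<psi> f)}"

definition uniformly_converges :: "(nat \<Rightarrow> hardy2 \<Rightarrow> hardy2) \<Rightarrow> (hardy2 \<Rightarrow> hardy2) \<Rightarrow> bool" where
  "uniformly_converges A L \<longleftrightarrow>
     bounded_linear L \<and> (\<lambda>n. onorm (\<lambda>f. A n f - L f)) \<longlonglongrightarrow> 0"

definition strongly_converges :: "(nat \<Rightarrow> hardy2 \<Rightarrow> hardy2) \<Rightarrow> (hardy2 \<Rightarrow> hardy2) \<Rightarrow> bool" where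
  "strongly_converges A L \<longleftrightarrow> (\<forall>f. (\<lambda>n. A n f) \<longlonglongrightarrow> L f)"

definition weakly_converges :: "(nat \<Rightarrow> hardy2 \<Rightarrow> hardy2) \<Rightarrow> (hardy2 \<Rightarrow> hardy2) \<Rightarrow> bool" where
  "weakly_converges A L \<longleftrightarrow> (\<forall>f. \<forall>\<psi>\<in>hardy2_dual. (\<lambda>n. \<psi> (A n f)) \<longlonglongrightarrow> \<psi> (L f))"

end

theory Submission
  imports Defs
begin

text \<open>
  Since \<open>\<mu> ^ k = 1\<close>, the power \<open>T ^^ (k * n)\<close> is multiplication by \<open>v ^ n\<close>, so everything is governed by
  the powers of \<open>v\<close>. Evaluating \<open>v ^ n\<close> at a point where \<open>\<bar>v\<bar> > 1\<close> rules out weak convergence, and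
  \<open>\<parallel>v\<parallel> = 1\<close> makes \<open>T\<close> power bounded. For non-constant \<open>v\<close> the maximum principle gives \<open>\<bar>v\<bar> < 1\<close>
  in the disc, so the Taylor coefficients of \<open>T ^^ n f\<close> tend to \<open>0\<close>, and power bounded sequences whose
  Taylor coefficients tend to \<open>0\<close> are weakly null.

  Strong convergence amounts to \<open>v ^ n \<longlonglongrightarrow> 0\<close> in \<open>H2\<close>, that is, to the behaviour of
  the integrals of \<open>\<bar>v\<bar> ^ (2 * n)\<close> over the circle, by dominated convergence along the radii. This needs
  Fatou's theorem on radial limits. It follows from a weak-type estimate of the radial maximal function,
  because polynomials are dense. To avoid boundary functions, the estimate is proved on circles of
  radius \<open>\<rho> < 1\<close>, where \<open>\<bar>f\<bar>\<^sup>2\<close> is continuous: the Poisson formula for \<open>f\<^sup>2\<close> bounds it by the centred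
  averages on the circle, and these are controlled by Vitali's covering lemma.
\<close>

section \<open>Taylor coefficients and Parseval\<close>

definition taylor_coeff :: "(complex \<Rightarrow> complex) \<Rightarrow> nat \<Rightarrow> complex" where
  "taylor_coeff f n = (deriv ^^ n) f 0 / fact n"

text \<open>An explicit primitive, which takes the same value at both ends of the period when
  \<open>n \<noteq> 0\<close>.\<close>

lemma has_integral_cis_int:
  "((\<lambda>t. cis (of_int n * t)) has_integral (if n = 0 then 2*pi else 0)) {0..2*pi}"
proof (cases "n = 0")
  case True
  then show ?thesis
    using has_integral_const_real[of "1::complex" 0 "2*pi"] by (simp add: scaleR_conv_of_real)
next
  case False
  have "((\<lambda>t. cis (of_int n * t)) has_integral
      (cis (of_int n * (2*pi)) / (\<i> * of_int n) - cis (of_int n * 0) / (\<i> * of_int n))) {0..2*pi}"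
  proof (rule fundamental_theorem_of_calculus)
    fix t :: real
    have "((\<lambda>z. exp (\<i> * of_int n * z) / (\<i> * of_int n)) has_field_derivative
        exp (\<i> * of_int n * of_real t)) (at (of_real t))"
      using False by (auto intro!: derivative_eq_intros)
    from has_vector_derivative_real_field[OF this, of "{0..2*pi}"]
    show "((\<lambda>t. cis (of_int n * t) / (\<i> * of_int n)) has_vector_derivative cis (of_int n * t))
        (at t within {0..2*pi})"
      by (simp add: cis_conv_exp mult_ac)
  qed simp
  then show ?thesis
    using False cis_multiple_2pi[of "of_int n"] by (simp add: mult_ac)
qed

text \<open>Expanding the squared modulus as a double sum leaves only the diagonal terms, by
  orthogonality of the functions \<open>cis (n * t)\<close>. This finite Parseval identity serves
  both partial sums of power series and polynomials.\<close>

lemma has_integral_trig_poly: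
  fixes c :: "nat \<Rightarrow> complex"
  shows "((\<lambda>t. (cmod (\<Sum>n<N. c n * cis (real n * t)))\<^sup>2) has_integral
    2*pi * (\<Sum>n<N. (cmod (c n))\<^sup>2)) {0..2*pi}"
proof -
  have "((\<lambda>t. \<Sum>m<N. \<Sum>n<N. c m * cnj (c n) * cis (of_int (int m - int n) * t)) has_integral
      (\<Sum>m<N. \<Sum>n<N. c m * cnj (c n) * (if int m - int n = 0 then 2*pi else 0))) {0..2*pi}"
    by (intro has_integral_sum has_integral_mult_right finite_lessThan has_integral_cis_int[THEN has_integral_eq_rhs]) auto
  moreover have "(\<Sum>m<N. \<Sum>n<N. c m * cnj (c n) * cis (of_int (int m - int n) * t)) =
      of_real ((cmod (\<Sum>n<N. c n * cis (real n * t)))\<^sup>2)" for t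
  proof -
    have "c m * cnj (c n) * cis (of_int (int m - int n) * t) =
        c m * cis (real m * t) * cnj (c n * cis (real n * t))" for m n
    proof -
      have "cis (of_int (int m - int n) * t) = cis (real m * t) * cis (- (real n * t))"
        unfolding cis_mult by (simp add: left_diff_distrib)
      then show ?thesis
        by (simp add: cis_cnj)
    qed
    then show ?thesis
      unfolding complex_norm_square by (simp only: sum_product cnj_sum)
  qed
  moreover have "(\<Sum>n<N. c m * cnj (c n) * (if int m - int n = 0 then 2*pi else 0)) =
      of_real (2*pi * (cmod (c m))\<^sup>2)" if "m < N" for m
  proof -
    have "(\<Sum>n<N. c m * cnj (c n) * (if int m - int n = 0 then 2*pi else 0)) =
        (\<Sum>n<N. if m = n then c m * cnj (c m) * (2*pi) else 0)"
      by (intro sum.cong) auto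
    then show ?thesis
      using that by (simp add: complex_norm_square[symmetric])
  qed
  ultimately have "((\<lambda>t. complex_of_real ((cmod (\<Sum>n<N. c n * cis (real n * t)))\<^sup>2)) has_integral
      of_real (2*pi * (\<Sum>n<N. (cmod (c n))\<^sup>2))) {0..2*pi}"
    by (simp add: sum_distrib_left)
  from has_integral_linear[OF this bounded_linear_Re] show ?thesis
    by (simp add: o_def)
qed

text \<open>Absolute summability bounds all partial sums by the constant \<open>?S\<close>, so
  dominated convergence carries the finite identity to the limit \<open>F\<close>.\<close>

lemma parseval_cis:
  fixes c :: "nat \<Rightarrow> complex"
  assumes c: "summable (\<lambda>n. cmod (c n))"
    and F: "\<And>t. (\<lambda>n. c n * cis (real n * t)) sums F t"
  shows "(\<lambda>n. (cmod (c n))\<^sup>2) sums (integral {0..2*pi} (\<lambda>t. (cmod (F t))\<^sup>2) / (2*pi))"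
proof -
  let ?s = "\<lambda>N t. \<Sum>n<N. c n * cis (real n * t)"
  let ?S = "\<Sum>n. cmod (c n)"
  have "(\<lambda>N. integral {0..2*pi} (\<lambda>t. (cmod (?s N t))\<^sup>2)) \<longlonglongrightarrow> integral {0..2*pi} (\<lambda>t. (cmod (F t))\<^sup>2)"
  proof (rule dominated_convergence(2))
    show "(\<lambda>t. (cmod (?s N t))\<^sup>2) integrable_on {0..2*pi}" for N
      using has_integral_trig_poly by blast
    show "(\<lambda>t::real. ?S\<^sup>2) integrable_on {0..2*pi}"
      by (rule integrable_const_ivl)
    fix N and t :: real
    have "cmod (?s N t) \<le> (\<Sum>n<N. cmod (c n))"
      by (rule order_trans[OF norm_sum]) (simp add: norm_mult)
    also have "\<dots> \<le> ?S"
      by (rule sum_le_suminf[OF c]) auto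
    finally show "norm ((cmod (?s N t))\<^sup>2) \<le> ?S\<^sup>2"
      by (simp add: power_mono)
  next
    fix t :: real
    show "(\<lambda>N. (cmod (?s N t))\<^sup>2) \<longlonglongrightarrow> (cmod (F t))\<^sup>2"
      using F[of t] unfolding sums_def by (intro tendsto_intros)
  qed
  then have "(\<lambda>N. 2*pi * (\<Sum>n<N. (cmod (c n))\<^sup>2) / (2*pi)) \<longlonglongrightarrow>
      integral {0..2*pi} (\<lambda>t. (cmod (F t))\<^sup>2) / (2*pi)"
    unfolding integral_unique[OF has_integral_trig_poly] by (intro tendsto_intros) auto
  then show ?thesis
    by (simp add: sums_def)
qed

lemma taylor_coeff_sums:
  assumes "f holomorphic_on ball 0 1" "z \<in> ball 0 1"
  shows "(\<lambda>n. taylor_coeff f n * z ^ n) sums f z"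
  using holomorphic_power_series[OF assms] by (simp add: taylor_coeff_def)

text \<open>Plain convergence at a radius \<open>R\<close> strictly between \<open>r\<close> and 1
  gives absolute convergence at \<open>r\<close>.\<close>

lemma summable_taylor_coeff:
  assumes f: "f holomorphic_on ball 0 1" and r: "0 \<le> r" "r < 1"
  shows "summable (\<lambda>n. cmod (taylor_coeff f n * of_real r ^ n))"
proof -
  obtain R where R: "r < R" "R < 1"
    using r dense by blast
  have "complex_of_real R \<in> ball 0 1"
    using R r by simp
  then have "summable (\<lambda>n. taylor_coeff f n * of_real R ^ n)"
    using taylor_coeff_sums[OF f] sums_summable by blast
  then show ?thesis
    by (rule powser_insidea) (use R r in simp)
qed

text \<open>Parseval on the circle of radius \<open>r\<close>. The square mean becomes a power
  series in \<open>r\<close> with nonnegative coefficients, from which its monotonicity can be read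
  off.\<close>

lemma sq_mean_sums:
  assumes f: "f holomorphic_on ball 0 1" and r: "0 \<le> r" "r < 1"
  shows "(\<lambda>n. (cmod (taylor_coeff f n))\<^sup>2 * r ^ (2*n)) sums sq_mean f r"
proof -
  have "(\<lambda>n. taylor_coeff f n * of_real r ^ n * cis (real n * t)) sums f (of_real r * cis t)" for t
    using taylor_coeff_sums[OF f circle_in_ball[OF r, of t]]
    by (simp only: power_mult_distrib Complex.DeMoivre mult.assoc)
  from parseval_cis[OF summable_taylor_coeff[OF f r] this] show ?thesis
    using r by (simp add: sq_mean_def norm_mult norm_power power_mult_distrib power_mult[symmetric] mult.commute[of _ 2])
qed

lemma sq_mean_mono:
  assumes f: "f holomorphic_on ball 0 1" and "0 \<le> r" "r \<le> s" "s < 1"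
  shows "sq_mean f r \<le> sq_mean f s"
  by (rule sums_le[OF _ sq_mean_sums[OF f] sq_mean_sums[OF f]])
    (use assms in \<open>auto intro!: mult_left_mono power_mono\<close>)

text \<open>For \<open>r < 1\<close> each partial sum lies below the square mean and hence below the
  squared norm. Being a polynomial in \<open>r\<close> it is continuous, and letting
  \<open>r\<close> tend to 1 removes the powers of \<open>r\<close>.\<close>

lemma sum_taylor_coeff_le:
  assumes f: "f \<in> H2"
  shows "(\<Sum>n<N. (cmod (taylor_coeff f n))\<^sup>2) \<le> (H2_norm f)\<^sup>2"
proof (rule tendsto_upperbound)
  let ?g = "\<lambda>r::real. \<Sum>n<N. (cmod (taylor_coeff f n))\<^sup>2 * r ^ (2*n)"
  have "(?g \<longlongrightarrow> ?g 1) (at_left 1)"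
    by (intro tendsto_intros)
  then show "(?g \<longlongrightarrow> (\<Sum>n<N. (cmod (taylor_coeff f n))\<^sup>2)) (at_left 1)"
    by simp
  have "?g r \<le> (H2_norm f)\<^sup>2" if r: "0 < r" "r < 1" for r
  proof -
    have "?g r \<le> sq_mean f r"
      using r sq_mean_sums[OF H2_holo[OF f], of r]
      by (intro sum_le_suminf[THEN order_trans[OF _ eq_refl]]) (auto simp: sums_iff)
    also have "\<dots> \<le> (H2_norm f)\<^sup>2"
      using r f by (intro sq_mean_le_H2_norm) auto
    finally show ?thesis .
  qed
  then show "\<forall>\<^sub>F r in at_left 1. ?g r \<le> (H2_norm f)\<^sup>2"
    unfolding eventually_at_left_field by (intro exI[of _ 0]) auto
qed simp

lemma summable_sq_taylor_coeff:
  assumes f: "f \<in> H2"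
  shows "summable (\<lambda>n. (cmod (taylor_coeff f n))\<^sup>2)"
  by (rule bounded_imp_summable[where B = "(H2_norm f)\<^sup>2"])
    (use sum_taylor_coeff_le[OF f, of "Suc _"] in \<open>auto simp: lessThan_Suc_atMost\<close>)

lemma cmod_taylor_coeff_le:
  assumes "f \<in> H2"
  shows "cmod (taylor_coeff f n) \<le> H2_norm f"
proof (rule power2_le_imp_le)
  have "(cmod (taylor_coeff f n))\<^sup>2 \<le> (\<Sum>i<Suc n. (cmod (taylor_coeff f i))\<^sup>2)"
    by (rule member_le_sum) auto
  then show "(cmod (taylor_coeff f n))\<^sup>2 \<le> (H2_norm f)\<^sup>2"
    using sum_taylor_coeff_le[OF assms] order_trans by blast
qed (simp add: H2_norm_nonneg assms)

section \<open>Approximation by Taylor polynomials in the Hardy norm\<close>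

definition taylor_poly :: "(complex \<Rightarrow> complex) \<Rightarrow> nat \<Rightarrow> complex \<Rightarrow> complex" where
  "taylor_poly f N z = (\<Sum>n<N. taylor_coeff f n * z ^ n)"

text \<open>Subtracting the polynomial deletes the first \<open>N\<close> coefficients, so Parseval
  leaves a tail. The bound is independent of \<open>r\<close> and hence also bounds the squared norm
  of the difference.\<close>

lemma sq_mean_minus_taylor_poly_le:
  assumes f: "f \<in> H2" and r: "0 \<le> r" "r < 1"
  shows "sq_mean (\<lambda>z. f z - taylor_poly f N z) r \<le> (\<Sum>n. (cmod (taylor_coeff f (n + N)))\<^sup>2)"
proof -
  let ?a = "taylor_coeff f"
  let ?c = "\<lambda>n. if n < N then 0 else ?a n * of_real r ^ n"
  have 1: "summable (\<lambda>n. cmod (?c n))"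
    by (rule summable_comparison_test'[OF summable_taylor_coeff[OF H2_holo[OF f] r]]) auto
  have "(\<lambda>n. ?c n * cis (real n * t)) sums
      (f (of_real r * cis t) - taylor_poly f N (of_real r * cis t))" for t
  proof -
    have "(\<lambda>n. ?a n * (of_real r * cis t) ^ n - (if n < N then ?a n * (of_real r * cis t) ^ n else 0)) sums
      (f (of_real r * cis t) - taylor_poly f N (of_real r * cis t))"
      using sums_If_finite_set[of "{..<N}" "\<lambda>n. ?a n * (of_real r * cis t) ^ n"]
      unfolding taylor_poly_def
      by (intro sums_diff taylor_coeff_sums H2_holo f circle_in_ball r) simp
    moreover have "?a n * (of_real r * cis t) ^ n - (if n < N then ?a n * (of_real r * cis t) ^ n else 0) =
        ?c n * cis (real n * t)" for n
      by (simp add: power_mult_distrib Complex.DeMoivre[symmetric])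
    ultimately show ?thesis
      by simp
  qed
  from parseval_cis[OF 1 this]
  have "(\<lambda>n. (cmod (?c n))\<^sup>2) sums sq_mean (\<lambda>z. f z - taylor_poly f N z) r"
    by (simp add: sq_mean_def)
  then have 2: "(\<lambda>n. (cmod (?c (n + N)))\<^sup>2) sums sq_mean (\<lambda>z. f z - taylor_poly f N z) r"
    using sums_iff_shift[of "\<lambda>n. (cmod (?c n))\<^sup>2" N] by simp
  have 3: "(\<lambda>n. (cmod (?a (n + N)))\<^sup>2) sums (\<Sum>n. (cmod (?a (n + N)))\<^sup>2)"
    by (rule summable_sums[OF summable_ignore_initial_segment[OF summable_sq_taylor_coeff[OF f]]])
  have 4: "(cmod (?c (n + N)))\<^sup>2 \<le> (cmod (?a (n + N)))\<^sup>2" for n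
  proof (rule power_mono)
    have "r ^ (n + N) \<le> 1"
      using r by (intro power_le_one) auto
    then show "cmod (?c (n + N)) \<le> cmod (?a (n + N))"
      using r by (simp add: norm_mult norm_power mult_left_le)
  qed simp
  show ?thesis
    by (rule sums_le[OF 4 2 3])
qed

lemma H2_power: "(\<lambda>z. z ^ n) \<in> H2"
proof (rule H2I)
  fix r :: real assume r: "0 \<le> r" "r < 1"
  have "r ^ n * r ^ n \<le> 1"
    using r by (intro mult_le_one power_le_one) auto
  then show "sq_mean (\<lambda>z. z ^ n) r \<le> 1"
    using r by (simp add: sq_mean_def norm_mult norm_power power2_eq_square)
qed (intro holomorphic_intros)

lemma H2_sum: "(\<And>i. i \<in> A \<Longrightarrow> f i \<in> H2) \<Longrightarrow> (\<lambda>z. \<Sum>i\<in>A. f i z) \<in> H2"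
  by (induction A rule: infinite_finite_induct) (auto intro: H2_zero H2_add)

lemma H2_taylor_poly: "taylor_poly f N \<in> H2"
  unfolding taylor_poly_def by (intro H2_sum H2_cmult H2_power)

lemma H2_diff: "f \<in> H2 \<Longrightarrow> g \<in> H2 \<Longrightarrow> (\<lambda>z. f z - g z) \<in> H2"
  using H2_add[of f "\<lambda>z. -1 * g z"] H2_cmult[of g "-1"] by simp

lemma H2_norm_minus_taylor_poly_tendsto_0:
  assumes f: "f \<in> H2"
  shows "(\<lambda>N. H2_norm (\<lambda>z. f z - taylor_poly f N z)) \<longlonglongrightarrow> 0"
proof (rule tendsto_sandwich)
  let ?R = "\<lambda>N. \<Sum>n. (cmod (taylor_coeff f (n + N)))\<^sup>2"
  have nn: "0 \<le> ?R N" for N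
    by (rule suminf_nonneg[OF summable_ignore_initial_segment[OF summable_sq_taylor_coeff[OF f]]]) simp
  show "\<forall>\<^sub>F N in sequentially. 0 \<le> H2_norm (\<lambda>z. f z - taylor_poly f N z)"
    by (intro always_eventually allI H2_norm_nonneg H2_diff f H2_taylor_poly)
  show "\<forall>\<^sub>F N in sequentially. H2_norm (\<lambda>z. f z - taylor_poly f N z) \<le> sqrt (?R N)"
    using nn by (intro always_eventually allI H2_norm_le) (simp_all add: sq_mean_minus_taylor_poly_le f)
  have "?R \<longlonglongrightarrow> 0"
    using suminf_exist_split2[OF summable_sq_taylor_coeff[OF f]] .
  from tendsto_real_sqrt[OF this] show "(\<lambda>N. sqrt (?R N)) \<longlonglongrightarrow> 0"
    by simp
qed simp

section \<open>Point evaluations and weak convergence\<close>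

text \<open>Every Taylor coefficient is bounded by the norm, so the power series is dominated by a
  geometric series. This makes point evaluation a continuous functional.\<close>

lemma cmod_H2_le:
  assumes f: "f \<in> H2" and z: "z \<in> ball 0 1"
  shows "cmod (f z) \<le> H2_norm f / (1 - cmod z)"
proof -
  have z1: "cmod z < 1"
    using z by simp
  have 1: "(\<lambda>n. taylor_coeff f n * z ^ n) sums f z"
    by (rule taylor_coeff_sums[OF H2_holo[OF f] z])
  have 2: "(\<lambda>n. H2_norm f * cmod z ^ n) sums (H2_norm f * (1 / (1 - cmod z)))"
    using z1 by (intro sums_mult geometric_sums) simp
  have "norm (\<Sum>n. taylor_coeff f n * z ^ n) \<le> (\<Sum>n. H2_norm f * cmod z ^ n)"
    by (rule norm_suminf_le[OF _ sums_summable[OF 2]])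
      (auto simp: norm_mult norm_power intro!: mult_right_mono cmod_taylor_coeff_le f)
  then show ?thesis
    using sums_unique[OF 1] sums_unique[OF 2] by simp
qed

lemma cmod_hardy2_le: "z \<in> ball 0 1 \<Longrightarrow> cmod (hardy2_fun f z) \<le> norm f / (1 - cmod z)"
  unfolding norm_hardy2_def by (rule cmod_H2_le[OF hardy2_fun_H2])

lemma point_evaluation_dual:
  assumes z: "z \<in> ball 0 1"
  shows "(\<lambda>f. hardy2_fun f z) \<in> hardy2_dual"
proof -
  have "bounded_linear (\<lambda>f. hardy2_fun f z)"
  proof (rule bounded_linear_intro[where K = "1 / (1 - cmod z)"])
    show "norm (hardy2_fun f z) \<le> norm f * (1 / (1 - cmod z))" for f
      using cmod_hardy2_le[OF z, of f] by simp
  qed (simp_all add: plus_hardy2.rep_eq scaleR_hardy2_def cscale.rep_eq scaleR_conv_of_real)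
  then show ?thesis
    by (simp add: hardy2_dual_def cscale.rep_eq)
qed

section \<open>Functionals in coordinates and weakly null sequences\<close>

text \<open>The monomials serve as coordinates for functionals; \<open>hmonom 0\<close>, the
  constant 1, is also the test vector whose images under \<open>T ^^ (k * n)\<close> are the powers
  of \<open>v\<close>.\<close>

definition hmonom :: "nat \<Rightarrow> hardy2" where
  "hmonom n = to_hardy2 (\<lambda>z. z ^ n)"

lemma hardy2_fun_hmonom: "z \<in> ball 0 1 \<Longrightarrow> hardy2_fun (hmonom n) z = z ^ n"
  unfolding hmonom_def by (rule hardy2_fun_to_hardy2[OF H2_power])

lemma hardy2_fun_sum: "hardy2_fun (\<Sum>i\<in>A. f i) z = (\<Sum>i\<in>A. hardy2_fun (f i) z)"
  by (induction A rule: infinite_finite_induct) (auto simp: zero_hardy2.rep_eq plus_hardy2.rep_eq)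

lemma hardy2_fun_diff: "hardy2_fun (f - g) z = hardy2_fun f z - hardy2_fun g z"
  by (simp add: minus_hardy2_def uminus_hardy2_def plus_hardy2.rep_eq cscale.rep_eq)

text \<open>Finite Parseval on each circle, where the factors \<open>r ^ n\<close> can only decrease
  the sum.\<close>

lemma norm_hpoly_le: "norm (\<Sum>n<N. cscale (c n) (hmonom n)) \<le> sqrt (\<Sum>n<N. (cmod (c n))\<^sup>2)"
  unfolding norm_hardy2_def
proof (rule H2_norm_le)
  fix r :: real assume r: "0 \<le> r" "r < 1"
  have "sq_mean (hardy2_fun (\<Sum>n<N. cscale (c n) (hmonom n))) r =
      sq_mean (\<lambda>z. \<Sum>n<N. c n * z ^ n) r"
    by (rule sq_mean_cong[OF _ r]) (simp add: hardy2_fun_sum cscale.rep_eq hardy2_fun_hmonom)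
  also have "\<dots> = integral {0..2*pi}
      (\<lambda>t. (cmod (\<Sum>n<N. (c n * of_real r ^ n) * cis (real n * t)))\<^sup>2) / (2*pi)"
    by (simp add: sq_mean_def power_mult_distrib Complex.DeMoivre mult.assoc)
  also have "\<dots> = (\<Sum>n<N. (cmod (c n * of_real r ^ n))\<^sup>2)"
    unfolding integral_unique[OF has_integral_trig_poly] by simp
  also have "\<dots> \<le> (\<Sum>n<N. (cmod (c n))\<^sup>2)"
    using r by (intro sum_mono power_mono) (auto simp: norm_mult norm_power mult_left_le power_le_one)
  also have "\<dots> = (sqrt (\<Sum>n<N. (cmod (c n))\<^sup>2))\<^sup>2"
    by (simp add: sum_nonneg)
  finally show "sq_mean (hardy2_fun (\<Sum>n<N. cscale (c n) (hmonom n))) r \<le> \<dots>" .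
qed (simp add: sum_nonneg)

context
  fixes \<psi> :: "hardy2 \<Rightarrow> complex"
  assumes \<psi>: "\<psi> \<in> hardy2_dual"
begin

lemma dual_hpoly: "\<psi> (\<Sum>n<N. cscale (c n) (hmonom n)) = (\<Sum>n<N. c n * \<psi> (hmonom n))"
proof -
  have "bounded_linear \<psi>"
    using \<psi> by (simp add: hardy2_dual_def)
  then have "linear \<psi>"
    by (rule bounded_linear.linear)
  then show ?thesis
    using \<psi> by (simp add: linear_sum hardy2_dual_def)
qed

text \<open>Testing \<psi> on the polynomial whose coefficients are the conjugates of its own values
  gives \<open>?S \<le> onorm \<psi> * sqrt ?S\<close>, hence
  \<open>?S \<le> (onorm \<psi>)^2\<close>, uniformly in \<open>N\<close>. Together with
  \<open>dual_sums\<close> this does the work of the Riesz representation.\<close>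

lemma summable_dual_coeff: "summable (\<lambda>n. (cmod (\<psi> (hmonom n)))\<^sup>2)"
proof (rule bounded_imp_summable)
  have bl: "bounded_linear \<psi>"
    using \<psi> by (simp add: hardy2_dual_def)
  fix N
  let ?b = "\<lambda>n. \<psi> (hmonom n)"
  let ?S = "\<Sum>n<Suc N. (cmod (?b n))\<^sup>2"
  have S0: "0 \<le> ?S"
    by (intro sum_nonneg) simp
  have *: "\<psi> (\<Sum>n<Suc N. cscale (cnj (?b n)) (hmonom n)) = of_real ?S"
    unfolding dual_hpoly of_real_sum complex_norm_square by (simp only: mult.commute)
  then have "?S = cmod (\<psi> (\<Sum>n<Suc N. cscale (cnj (?b n)) (hmonom n)))"
    by (simp only: * norm_of_real abs_of_nonneg[OF S0])
  also have "\<dots> \<le> onorm \<psi> * norm (\<Sum>n<Suc N. cscale (cnj (?b n)) (hmonom n))"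
    by (rule onorm[OF bl])
  also have "\<dots> \<le> onorm \<psi> * sqrt ?S"
    using norm_hpoly_le[of "\<lambda>n. cnj (?b n)" "Suc N"]
    by (intro mult_left_mono onorm_pos_le[OF bl]) simp
  finally have "sqrt ?S * sqrt ?S \<le> onorm \<psi> * sqrt ?S"
    using S0 by simp
  moreover have "s \<le> K" if "s * s \<le> K * s" "0 \<le> s" "0 \<le> K" for s K :: real
    using that by (cases "s = 0") auto
  ultimately have "sqrt ?S \<le> onorm \<psi>"
    using real_sqrt_ge_zero[OF S0] onorm_pos_le[OF bl] by blast
  then have "(sqrt ?S)\<^sup>2 \<le> (onorm \<psi>)\<^sup>2"
    using S0 by (intro power_mono) auto
  then show "(\<Sum>n\<le>N. (cmod (?b n))\<^sup>2) \<le> (onorm \<psi>)\<^sup>2"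
    using S0 by (simp add: lessThan_Suc_atMost)
qed simp

text \<open>The Taylor polynomials converge to \<open>g\<close> in norm and \<psi> is
  continuous.\<close>

lemma dual_sums: "(\<lambda>n. taylor_coeff (hardy2_fun g) n * \<psi> (hmonom n)) sums \<psi> g"
proof -
  have bl: "bounded_linear \<psi>"
    using \<psi> by (simp add: hardy2_dual_def)
  let ?P = "\<lambda>N. \<Sum>n<N. cscale (taylor_coeff (hardy2_fun g) n) (hmonom n)"
  have "norm (g - ?P N) = H2_norm (\<lambda>z. hardy2_fun g z - taylor_poly (hardy2_fun g) N z)" for N
    unfolding norm_hardy2_def
    by (rule H2_norm_cong)
      (simp add: hardy2_fun_diff hardy2_fun_sum cscale.rep_eq hardy2_fun_hmonom taylor_poly_def)
  then have "(\<lambda>N. norm (g - ?P N)) \<longlonglongrightarrow> 0"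
    using H2_norm_minus_taylor_poly_tendsto_0[OF hardy2_fun_H2] by simp
  then have "(\<lambda>N. g - ?P N) \<longlonglongrightarrow> 0"
    by (rule tendsto_norm_zero_cancel)
  from tendsto_diff[OF tendsto_const[of g] this] have "?P \<longlonglongrightarrow> g"
    by simp
  then have "(\<lambda>N. \<psi> (?P N)) \<longlonglongrightarrow> \<psi> g"
    by (rule bounded_linear.tendsto[OF bl])
  then show ?thesis
    unfolding dual_hpoly sums_def .
qed

text \<open>The first \<open>M\<close> coefficients are kept and the others are estimated by
  Cauchy-Schwarz. For large \<open>M\<close> the second summand is small uniformly on bounded
  sets.\<close>

lemma cmod_dual_le:
  "cmod (\<psi> g) \<le> (\<Sum>n<M. cmod (taylor_coeff (hardy2_fun g) n) * cmod (\<psi> (hmonom n))) +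
     norm g * sqrt (\<Sum>n. (cmod (\<psi> (hmonom (n + M))))\<^sup>2)"
proof -
  let ?a = "taylor_coeff (hardy2_fun g)"
  let ?b = "\<lambda>n. \<psi> (hmonom n)"
  let ?R = "\<Sum>n. (cmod (?b (n + M)))\<^sup>2"
  let ?A = "\<Sum>n<M. cmod (?a n) * cmod (?b n)"
  have sumR: "summable (\<lambda>n. (cmod (?b (n + M)))\<^sup>2)"
    by (rule summable_ignore_initial_segment[OF summable_dual_coeff])
  have le: "cmod (\<Sum>n<N + M. ?a n * ?b n) \<le> ?A + norm g * sqrt ?R" for N
  proof -
    have "cmod (\<Sum>n<N + M. ?a n * ?b n) \<le> (\<Sum>n<N + M. cmod (?a n) * cmod (?b n))"
      by (rule order_trans[OF norm_sum]) (simp add: norm_mult)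
    also have "\<dots> = ?A + (\<Sum>n<N. cmod (?a (n + M)) * cmod (?b (n + M)))"
      using sum.atLeastLessThan_concat[of 0 M "N + M" "\<lambda>n. cmod (?a n) * cmod (?b n)"]
        sum.shift_bounds_nat_ivl[of "\<lambda>n. cmod (?a n) * cmod (?b n)" 0 M N]
      by (simp add: atLeast0LessThan)
    also have "(\<Sum>n<N. cmod (?a (n + M)) * cmod (?b (n + M))) \<le> norm g * sqrt ?R"
    proof (rule power2_le_imp_le)
      have "(\<Sum>n<N. cmod (?a (n + M)) * cmod (?b (n + M)))\<^sup>2 \<le>
          (\<Sum>n<N. (cmod (?a (n + M)))\<^sup>2) * (\<Sum>n<N. (cmod (?b (n + M)))\<^sup>2)"
        by (rule Cauchy_Schwarz_ineq_sum)
      also have "\<dots> \<le> (norm g)\<^sup>2 * ?R"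
      proof (rule mult_mono)
        have "(\<Sum>n<N. (cmod (?a (n + M)))\<^sup>2) = (\<Sum>n\<in>(\<lambda>n. n + M) ` {..<N}. (cmod (?a n))\<^sup>2)"
          by (simp add: sum.reindex)
        also have "\<dots> \<le> (\<Sum>n<N + M. (cmod (?a n))\<^sup>2)"
          by (rule sum_mono2) auto
        also have "\<dots> \<le> (norm g)\<^sup>2"
          unfolding norm_hardy2_def by (rule sum_taylor_coeff_le[OF hardy2_fun_H2])
        finally show "(\<Sum>n<N. (cmod (?a (n + M)))\<^sup>2) \<le> (norm g)\<^sup>2" .
        show "(\<Sum>n<N. (cmod (?b (n + M)))\<^sup>2) \<le> ?R"
          by (rule sum_le_suminf[OF sumR]) auto
      qed (auto intro: sum_nonneg)
      also have "\<dots> = (norm g * sqrt ?R)\<^sup>2"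
        using suminf_nonneg[OF sumR] by (simp add: power_mult_distrib)
      finally show "(\<Sum>n<N. cmod (?a (n + M)) * cmod (?b (n + M)))\<^sup>2 \<le> (norm g * sqrt ?R)\<^sup>2" .
      show "0 \<le> norm g * sqrt ?R"
        using suminf_nonneg[OF sumR] by simp
    qed
    finally show ?thesis by simp
  qed
  have "(\<lambda>N. \<Sum>n<N + M. ?a n * ?b n) \<longlonglongrightarrow> \<psi> g"
    using dual_sums[of g] unfolding sums_def by (rule LIMSEQ_ignore_initial_segment)
  then have "(\<lambda>N. cmod (\<Sum>n<N + M. ?a n * ?b n)) \<longlonglongrightarrow> cmod (\<psi> g)"
    by (rule tendsto_norm)
  then show ?thesis
    by (rule LIMSEQ_le_const2) (use le in blast)
qed

text \<open>First \<open>M\<close> is chosen, depending on \<open>B\<close> and \<psi> but not on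
  \<open>n\<close>, to make the tail small for all \<open>n\<close>; only finitely many coefficients
  then remain, and these tend to 0.\<close>

lemma dual_tendsto_0:
  assumes B: "\<And>n. norm (g n) \<le> B"
    and c: "\<And>i. (\<lambda>n. taylor_coeff (hardy2_fun (g n)) i) \<longlonglongrightarrow> 0"
  shows "(\<lambda>n. \<psi> (g n)) \<longlonglongrightarrow> 0"
proof (rule LIMSEQ_I)
  fix e :: real assume e: "0 < e"
  let ?b = "\<lambda>n. \<psi> (hmonom n)"
  let ?R = "\<lambda>M. \<Sum>n. (cmod (?b (n + M)))\<^sup>2"
  have "(\<lambda>M. B * sqrt (?R M)) \<longlonglongrightarrow> B * sqrt 0"
    by (intro tendsto_intros suminf_exist_split2 summable_dual_coeff)
  then have "\<forall>\<^sub>F M in sequentially. B * sqrt (?R M) < e / 2"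
    using e by (intro order_tendstoD(2)[where y = "B * sqrt 0"]) auto
  then obtain M where M: "B * sqrt (?R M) < e / 2"
    by (meson eventually_happens sequentially_bot)
  have R0: "0 \<le> ?R M"
    by (rule suminf_nonneg[OF summable_ignore_initial_segment[OF summable_dual_coeff]]) simp
  have "(\<lambda>n. \<Sum>i<M. cmod (taylor_coeff (hardy2_fun (g n)) i) * cmod (?b i)) \<longlonglongrightarrow>
      (\<Sum>i<M. cmod 0 * cmod (?b i))"
    by (intro tendsto_intros c)
  then have "\<forall>\<^sub>F n in sequentially.
      (\<Sum>i<M. cmod (taylor_coeff (hardy2_fun (g n)) i) * cmod (?b i)) < e / 2"
    using e by (intro order_tendstoD(2)[where y = "\<Sum>i<M. cmod 0 * cmod (?b i)"]) auto
  then obtain n0 where n0: "\<And>n. n \<ge> n0 \<Longrightarrow>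
      (\<Sum>i<M. cmod (taylor_coeff (hardy2_fun (g n)) i) * cmod (?b i)) < e / 2"
    unfolding eventually_sequentially by blast
  have "cmod (\<psi> (g n)) < e" if "n \<ge> n0" for n
  proof -
    have "norm (g n) * sqrt (?R M) \<le> B * sqrt (?R M)"
      using R0 by (intro mult_right_mono B) simp
    then show ?thesis
      using n0[OF that] M cmod_dual_le[of "g n" M] by linarith
  qed
  then show "\<exists>n0. \<forall>n\<ge>n0. norm (\<psi> (g n) - 0) < e"
    by auto
qed

end

section \<open>The radial maximal function\<close>

text \<open>Vitali's lemma selects a countable disjoint family of the intervals whose fivefold
  enlargements still cover \<open>A\<close>. Their lengths are controlled by integrals over disjoint
  intervals, all inside \<open>{a-B..b+B}\<close> since \<open>h \<le> B\<close>. The bound is put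
  on a measurable cover \<open>V\<close> because \<open>A\<close> is an arbitrary set.\<close>

lemma maximal_weak_type:
  fixes u :: "real \<Rightarrow> real"
  assumes u: "continuous_on UNIV u" "\<And>x. 0 \<le> u x" and \<beta>: "0 < \<beta>" and B: "0 \<le> B"
    and A: "A \<subseteq> {a..b}" "\<And>t. t \<in> A \<Longrightarrow> \<exists>h>0. h \<le> B \<and> 2 * h * \<beta> < integral {t-h..t+h} u"
  shows "\<exists>V\<in>lmeasurable. A \<subseteq> V \<and> measure lebesgue V \<le> 5 / \<beta> * integral {a-B..b+B} u"
proof -
  have "\<exists>h. \<forall>t\<in>A. 0 < h t \<and> h t \<le> B \<and> 2 * h t * \<beta> < integral {t-h t..t+h t} u"
    using A(2) by (intro bchoice) blast
  then obtain h where h: "\<And>t. t \<in> A \<Longrightarrow> 0 < h t \<and> h t \<le> B \<and> 2 * h t * \<beta> < integral {t-h t..t+h t} u"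
    by blast
  have "A \<subseteq> (\<Union>i\<in>A. ball i (h i))"
    using h by force
  then obtain C where C: "countable C" "C \<subseteq> A"
      "pairwise (\<lambda>i j. disjnt (ball i (h i)) (ball j (h j))) C" "A \<subseteq> (\<Union>i\<in>C. ball i (5 * h i))"
    by (rule Vitali_covering_lemma_balls[where S = A and K = A and a = "\<lambda>i. i" and r = h and B = B])
      (use h in \<open>blast intro: that\<close>)+
  have ii: "u integrable_on {x..y}" for x y
    by (intro integrable_continuous_real continuous_on_subset[OF u(1)]) auto
  \<comment> \<open>A bound for all finite subfamilies passes to the countable union.\<close>
  have bound: "measure lebesgue (\<Union>i\<in>I. ball i (5 * h i)) \<le> 5 / \<beta> * integral {a-B..b+B} u"
    if I: "I \<subseteq> C" "finite I" for I
  proof -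
    \<comment> \<open>\<open>?w i\<close> is \<open>u\<close> cut off to the selected interval
      around \<open>i\<close>. By disjointness at most one of these is nonzero at each point, so
      their sum stays below \<open>u\<close>.\<close>
    let ?w = "\<lambda>i x. if x \<in> {i - h i<..<i + h i} then u x else 0"
    have w: "?w i integrable_on {a-B..b+B}" "integral {a-B..b+B} (?w i) = integral {i - h i..i + h i} u"
      if "i \<in> I" for i
    proof -
      have "i \<in> A"
        using that I C by blast
      then have sub: "{i - h i<..<i + h i} \<inter> {a-B..b+B} = {i - h i<..<i + h i}"
        using A(1) h[OF \<open>i \<in> A\<close>] by (intro Int_absorb2) force
      show "integral {a-B..b+B} (?w i) = integral {i - h i..i + h i} u"
        unfolding Henstock_Kurzweil_Integration.integral_restrict_Int sub integral_open_interval_real ..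
      show "?w i integrable_on {a-B..b+B}"
        unfolding Henstock_Kurzweil_Integration.integrable_restrict_Int sub
        using ii[of "i - h i" "i + h i"] by (simp add: integrable_on_Icc_iff_Ioo)
    qed
    have "measure lebesgue (\<Union>i\<in>I. ball i (5 * h i)) \<le> (\<Sum>i\<in>I. measure lebesgue (ball i (5 * h i)))"
      by (rule measure_UNION_le) (use I in auto)
    also have "\<dots> \<le> (\<Sum>i\<in>I. 5 / \<beta> * integral {i - h i..i + h i} u)"
    proof (rule sum_mono)
      fix i assume "i \<in> I"
      then have hi: "0 < h i" "2 * h i * \<beta> < integral {i-h i..i+h i} u"
        using h I C by blast+
      have "measure lebesgue (ball i (5 * h i)) = 10 * h i"
        using hi by (simp add: ball_eq_greaterThanLessThan)
      also have "\<dots> = 5 / \<beta> * (2 * h i * \<beta>)"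
        using \<beta> by simp
      also have "\<dots> \<le> 5 / \<beta> * integral {i - h i..i + h i} u"
        using \<beta> hi by (intro mult_left_mono) auto
      finally show "measure lebesgue (ball i (5 * h i)) \<le> 5 / \<beta> * integral {i - h i..i + h i} u" .
    qed
    also have "\<dots> = 5 / \<beta> * integral {a-B..b+B} (\<lambda>x. \<Sum>i\<in>I. ?w i x)"
      by (subst Henstock_Kurzweil_Integration.integral_sum[OF I(2) w(1)])
        (simp_all only: w(2) sum_distrib_left cong: sum.cong)
    also have "\<dots> \<le> 5 / \<beta> * integral {a-B..b+B} u"
    proof (intro mult_left_mono integral_le)
      show "(\<lambda>x. \<Sum>i\<in>I. ?w i x) integrable_on {a-B..b+B}"
        by (rule Henstock_Kurzweil_Integration.integrable_sum[OF I(2) w(1)])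
      fix x
      show "(\<Sum>i\<in>I. ?w i x) \<le> u x"
      proof (cases "\<exists>j\<in>I. x \<in> ball j (h j)")
        case True
        then obtain j where j: "j \<in> I" "x \<in> ball j (h j)"
          by blast
        have "?w i x = (if i = j then u x else 0)" if "i \<in> I" for i
        proof (cases "i = j")
          case False
          then have "disjnt (ball i (h i)) (ball j (h j))"
            using that j(1) I(1) C(3) by (meson pairwiseD subsetD)
          then have "x \<notin> ball i (h i)"
            using j(2) unfolding disjnt_def by blast
          then show ?thesis
            using False unfolding ball_eq_greaterThanLessThan by auto
        qed (use j(2) in \<open>simp add: ball_eq_greaterThanLessThan\<close>)
        then have "(\<Sum>i\<in>I. ?w i x) = (\<Sum>i\<in>I. if i = j then u x else 0)"
          by (intro sum.cong) auto
        then show ?thesis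
          using I j by simp
      next
        case False
        then have "(\<Sum>i\<in>I. ?w i x) = 0"
          by (intro sum.neutral) (auto simp: ball_eq_greaterThanLessThan)
        then show ?thesis
          using u by simp
      qed
    qed (use \<beta> ii in auto)
    finally show ?thesis .
  qed
  show ?thesis
  proof (intro bexI conjI)
    show "A \<subseteq> (\<Union>i\<in>C. ball i (5 * h i))"
      by fact
    show "measure lebesgue (\<Union>i\<in>C. ball i (5 * h i)) \<le> 5 / \<beta> * integral {a-B..b+B} u"
      by (rule measure_UN_bound[OF C(1)]) (use bound in auto)
    show "(\<Union>i\<in>C. ball i (5 * h i)) \<in> lmeasurable"
      by (rule fmeasurable_UN_bound[OF C(1)]) (use bound in auto)
  qed
qed

section \<open>Poisson formula and Poisson kernel\<close>

text \<open>The factor \<open>(1 - |z|^2) / (1 - cnj z * \<zeta>)\<close> in \<open>h\<close> is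
  holomorphic on the closed disc and equals 1 at \<open>z\<close>. Cauchy's formula for
  \<open>h\<close> at \<open>z\<close> is therefore Poisson's formula for \<open>f\<close>.\<close>

lemma poisson_circle:
  assumes f: "f holomorphic_on ball 0 R" and R: "1 < R" and z: "cmod z < 1"
  shows "((\<lambda>t. of_real ((1 - (cmod z)\<^sup>2) / (cmod (cis t - z))\<^sup>2) * f (cis t)) has_integral
    2 * of_real pi * f z) {0..2*pi}"
proof -
  define h where "h = (\<lambda>\<zeta>. f \<zeta> * of_real (1 - (cmod z)\<^sup>2) / (1 - cnj z * \<zeta>))"
  have ne: "1 - cnj z * \<zeta> \<noteq> 0" if "cmod \<zeta> \<le> 1" for \<zeta>
  proof
    assume "1 - cnj z * \<zeta> = 0"
    then have "cmod (cnj z * \<zeta>) = 1"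
      by simp
    moreover have "cmod z * cmod \<zeta> \<le> cmod z * 1"
      using that by (intro mult_left_mono) auto
    ultimately show False
      using z by (simp add: norm_mult)
  qed
  have hz: "h z = f z"
  proof -
    have "of_real (1 - (cmod z)\<^sup>2) = 1 - cnj z * z"
      by (simp only: of_real_diff of_real_1 complex_norm_square mult.commute)
    then show ?thesis
      using ne[of z] z by (simp add: h_def)
  qed
  have "h holomorphic_on cball 0 1"
    unfolding h_def using ne R
    by (intro holomorphic_intros holomorphic_on_subset[OF f]) auto
  then have "((\<lambda>u. h u / (u - z)) has_contour_integral (2 * of_real pi * \<i> * h z)) (circlepath 0 1)"
    using z by (intro Cauchy_integral_circlepath_simple) auto
  then have hi: "((\<lambda>t. h (cis t) / (cis t - z) * \<i> * cis t) has_integral (2 * of_real pi * \<i> * h z)) {0..2*pi}"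
    unfolding circlepath_def by (subst (asm) has_contour_integral_part_circlepath_iff) auto
  have ieq: "- \<i> * (2 * of_real pi * \<i> * h z) = 2 * of_real pi * f z"
    by (simp add: hz algebra_simps)
  from has_integral_mult_right[OF hi, of "- \<i>"]
  have "((\<lambda>t. - \<i> * (h (cis t) / (cis t - z) * \<i> * cis t)) has_integral 2 * of_real pi * f z) {0..2*pi}"
    by (simp only: ieq)
  moreover have "- \<i> * (h (cis t) / (cis t - z) * \<i> * cis t) =
      of_real ((1 - (cmod z)\<^sup>2) / (cmod (cis t - z))\<^sup>2) * f (cis t)" for t
  proof -
    have nz: "cis t - z \<noteq> 0"
      using z norm_cis[of t] by auto
    have 1: "cis t * cnj (cis t) = 1"
      by (simp add: complex_norm_square[symmetric])
    \<comment> \<open>On the unit circle the inverse of \<open>cis t\<close> is its conjugate, so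
      the two linear factors combine to a squared modulus.\<close>
    have 2: "(1 - cnj z * cis t) * (cis t - z) = cis t * (of_real ((cmod (cis t - z))\<^sup>2))"
    proof -
      have "1 - cnj z * cis t = cis t * cnj (cis t - z)"
        using 1 by (simp add: algebra_simps)
      then show ?thesis
        unfolding complex_norm_square by (simp only: mult_ac)
    qed
    have "- \<i> * (h (cis t) / (cis t - z) * \<i> * cis t) = h (cis t) / (cis t - z) * cis t"
      by (simp add: algebra_simps)
    also have "\<dots> = f (cis t) * of_real (1 - (cmod z)\<^sup>2) * cis t / ((1 - cnj z * cis t) * (cis t - z))"
      by (simp add: h_def)
    also have "\<dots> = of_real ((1 - (cmod z)\<^sup>2) / (cmod (cis t - z))\<^sup>2) * f (cis t)"
      unfolding 2 using nz by (simp add: divide_simps)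
    finally show ?thesis .
  qed
  ultimately show ?thesis
    by simp
qed

text \<open>This is \<open>(1 - |z|^2) / |cis t - z|^2\<close> at the real point
  \<open>z = r\<close>, with the denominator expanded as in \<open>cmod_cis_minus\<close>. In this
  form evenness, periodicity and the derivative are visible.\<close>

definition poisson_kernel :: "real \<Rightarrow> real \<Rightarrow> real" where
  "poisson_kernel r t = (1 - r\<^sup>2) / (1 - 2 * r * cos t + r\<^sup>2)"

lemma cmod_cis_minus: "(cmod (cis t - of_real r))\<^sup>2 = 1 - 2 * r * cos t + r\<^sup>2"
proof -
  have "(cmod (cis t - of_real r))\<^sup>2 = (cos t)\<^sup>2 + (sin t)\<^sup>2 - 2 * r * cos t + r\<^sup>2"
    unfolding cmod_power2 by (simp add: power2_eq_square algebra_simps)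
  then show ?thesis
    by simp
qed

lemma poisson_denominator_pos:
  fixes r t :: real
  assumes "0 \<le> r" "r < 1"
  shows "0 < 1 - 2 * r * cos t + r\<^sup>2"
proof -
  have "cis t \<noteq> of_real r"
    using assms by (metis norm_cis norm_of_real abs_of_nonneg less_irrefl)
  then show ?thesis
    unfolding cmod_cis_minus[symmetric] by simp
qed

lemma poisson_kernel_pos: "0 \<le> r \<Longrightarrow> r < 1 \<Longrightarrow> 0 < poisson_kernel r t"
  using poisson_denominator_pos[of r t] by (simp add: poisson_kernel_def power_less_one_iff abs_square_less_1)

lemma poisson_kernel_minus [simp]: "poisson_kernel r (- t) = poisson_kernel r t"
  by (simp add: poisson_kernel_def)

lemma poisson_kernel_deriv:
  assumes "0 \<le> r" "r < 1"
  shows "(poisson_kernel r has_real_derivative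
    - ((1 - r\<^sup>2) * (2 * r * sin t) / (1 - 2 * r * cos t + r\<^sup>2)\<^sup>2)) (at t within S)"
  unfolding poisson_kernel_def using poisson_denominator_pos[OF assms, of t]
  by (auto intro!: derivative_eq_intros simp: power2_eq_square mult_ac)

lemma continuous_on_poisson_kernel:
  assumes "0 \<le> r" "r < 1"
  shows "continuous_on S (poisson_kernel r)"
  unfolding poisson_kernel_def using poisson_denominator_pos[OF assms]
  by (intro continuous_intros) (metis less_irrefl)

text \<open>Periodicity moves \<open>{pi..2*pi}\<close> to \<open>{-pi..0}\<close>, and reflection
  folds it onto \<open>{0..pi}\<close>. This brings integrals over the circle into the form in which
  centred averages can be used.\<close>

lemma integral_period_fold:
  fixes F :: "real \<Rightarrow> real"
  assumes F: "continuous_on UNIV F" and per: "\<And>t. F (t + 2*pi) = F t"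
  shows "integral {0..2*pi} F = integral {0..pi} (\<lambda>t. F t + F (-t))"
proof -
  have ii: "F integrable_on {x..y}" for x y
    by (intro integrable_continuous_real continuous_on_subset[OF F]) auto
  have ii': "(\<lambda>t. F (-t)) integrable_on {x..y}" for x y
    by (intro integrable_continuous_real continuous_on_compose2[OF F] continuous_intros) auto
  have "integral {0..2*pi} F = integral {0..pi} F + integral {pi..2*pi} F"
    by (rule Henstock_Kurzweil_Integration.integral_combine[symmetric]) (auto intro: ii)
  also have "integral {pi..2*pi} F = integral {-pi..0} F"
    using integral_shift_real_ivl[of pi "2*pi" "2*pi" F] by (simp add: per)
  also have "\<dots> = integral {0..pi} (\<lambda>t. F (-t))"
    using Henstock_Kurzweil_Integration.integral_reflect_real[of 0 "- pi" F] by simp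
  finally show ?thesis
    by (simp add: Henstock_Kurzweil_Integration.integral_add ii ii')
qed

text \<open>Poisson's formula for the constant function 1, halved because the kernel is
  even.\<close>

lemma poisson_kernel_integral:
  assumes r: "0 \<le> r" "r < 1"
  shows "integral {0..pi} (poisson_kernel r) = pi"
proof -
  have "((\<lambda>t. of_real ((1 - (cmod (of_real r))\<^sup>2) / (cmod (cis t - of_real r))\<^sup>2) * 1) has_integral
    2 * of_real pi * (1::complex)) {0..2*pi}"
    by (rule poisson_circle[of "\<lambda>_. 1" 2]) (use r in auto)
  from has_integral_linear[OF this bounded_linear_Re]
  have "(poisson_kernel r has_integral 2 * pi) {0..2*pi}"
    unfolding cmod_cis_minus by (simp add: o_def poisson_kernel_def[abs_def])
  moreover have "integral {0..2*pi} (poisson_kernel r) =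
      integral {0..pi} (\<lambda>t. poisson_kernel r t + poisson_kernel r (-t))"
    by (rule integral_period_fold[OF continuous_on_poisson_kernel[OF r]]) (simp add: poisson_kernel_def)
  ultimately show ?thesis
    by (simp add: integral_unique)
qed

text \<open>The kernel decreases on \<open>[0, \<pi>]\<close>, so integrating by parts against the primitive \<open>D\<close> of
  \<open>2\<beta> - u\<close>, which is nonnegative by assumption, yields the sharp constant.\<close>

lemma poisson_kernel_average_le:
  assumes r: "0 \<le> r" "r < 1" and u: "continuous_on {0..pi} u"
    and avg: "\<And>h. 0 < h \<Longrightarrow> h \<le> pi \<Longrightarrow> integral {0..h} u \<le> 2 * h * \<beta>"
  shows "integral {0..pi} (\<lambda>t. poisson_kernel r t * u t) \<le> 2 * pi * \<beta>"
proof -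
  let ?K = "poisson_kernel r"
  let ?K' = "\<lambda>t. - ((1 - r\<^sup>2) * (2 * r * sin t) / (1 - 2 * r * cos t + r\<^sup>2)\<^sup>2)"
  define D where "D t = 2 * t * \<beta> - integral {0..t} u" for t
  have D0: "0 \<le> D t" if "t \<in> {0..pi}" for t
    using that avg[of t] by (cases "t = 0") (auto simp: D_def)
  have D': "(D has_real_derivative 2 * \<beta> - u t) (at t within {0..pi})" if "t \<in> {0..pi}" for t
    unfolding D_def using integral_has_real_derivative[OF u that]
    by (auto intro!: derivative_eq_intros)
  have ftc: "((\<lambda>t. ?K' t * D t + (2 * \<beta> - u t) * ?K t) has_integral (?K pi * D pi - ?K 0 * D 0)) {0..pi}"
  proof (rule fundamental_theorem_of_calculus)
    fix t assume "t \<in> {0..pi}"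
    from DERIV_mult[OF poisson_kernel_deriv[OF r] D'[OF this]]
    show "((\<lambda>t. ?K t * D t) has_vector_derivative ?K' t * D t + (2 * \<beta> - u t) * ?K t) (at t within {0..pi})"
      by (simp add: has_real_derivative_iff_has_vector_derivative)
  qed simp
  have iK: "?K integrable_on {0..pi}"
    by (intro integrable_continuous_real continuous_on_poisson_kernel r)
  have iKu: "(\<lambda>t. ?K t * u t) integrable_on {0..pi}"
    by (intro integrable_continuous_real continuous_intros continuous_on_poisson_kernel r u)
  have hi: "((\<lambda>t. 2 * \<beta> * ?K t - ?K t * u t) has_integral
      (2 * \<beta> * pi - integral {0..pi} (\<lambda>t. ?K t * u t))) {0..pi}"
    using has_integral_diff[OF has_integral_mult_right[OF integrable_integral[OF iK], of "2 * \<beta>"]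
        integrable_integral[OF iKu]]
    unfolding poisson_kernel_integral[OF r] .
  have "?K pi * D pi - ?K 0 * D 0 \<le> 2 * \<beta> * pi - integral {0..pi} (\<lambda>t. ?K t * u t)"
  proof (rule has_integral_le[OF ftc hi])
    fix t assume t: "t \<in> {0..pi}"
    have "0 \<le> sin t" "r\<^sup>2 \<le> 1"
      using t r by (auto intro: sin_ge_zero simp: power_le_one)
    then have "?K' t \<le> 0"
      using r by simp
    then have "?K' t * D t \<le> 0"
      using D0[OF t] by (rule mult_nonpos_nonneg)
    then show "?K' t * D t + (2 * \<beta> - u t) * ?K t \<le> 2 * \<beta> * ?K t - ?K t * u t"
      by (simp add: algebra_simps)
  qed
  moreover have "0 \<le> ?K pi * D pi"
    using D0[of pi] poisson_kernel_pos[OF r, of pi] by simp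
  moreover have "D 0 = 0"
    by (simp add: D_def)
  ultimately show ?thesis
    by (simp add: mult_ac)
qed

text \<open>Since the square of \<open>f\<close> is holomorphic, Poisson's formula bounds
  \<open>|f|^2\<close> at an interior point by the Poisson integral of \<open>|f|^2\<close> on the
  circle. Folding it about \<open>t\<close> reduces the claim to the estimate by centred
  averages.\<close>

lemma cmod_radial_le:
  assumes f: "f holomorphic_on ball 0 R" and R: "1 < R" and r: "0 \<le> r" "r < 1"
    and avg: "\<And>h. 0 < h \<Longrightarrow> h \<le> pi \<Longrightarrow> integral {t-h..t+h} (\<lambda>s. (cmod (f (cis s)))\<^sup>2) \<le> 2 * h * \<beta>"
  shows "(cmod (f (of_real r * cis t)))\<^sup>2 \<le> \<beta>"
proof -
  define F where "F s = (cmod (f (cis s)))\<^sup>2" for s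
  define U where "U s = F (s + t)" for s
  \<comment> \<open>Rotation by \<open>cis t\<close> puts the point on the positive radius, where
    the kernel is even in the angle; squaring makes the modulus of \<open>g\<close> on the circle
    equal to \<open>|f|^2\<close>.\<close>
  define g where "g z = (f (cis t * z))\<^sup>2" for z
  have "continuous_on (ball 0 R) f"
    using f holomorphic_on_imp_continuous_on by blast
  then have F: "continuous_on UNIV F"
    unfolding F_def by (intro continuous_intros) (rule continuous_on_compose2, use R in \<open>auto intro!: continuous_intros\<close>)
  then have U: "continuous_on S U" for S
    unfolding U_def by (intro continuous_on_compose2[OF F] continuous_intros) auto
  have Um: "continuous_on S (\<lambda>s. U (- s))" for S
    by (intro continuous_on_compose2[OF U[of UNIV]] continuous_intros) auto
  have g: "g holomorphic_on ball 0 R"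
    unfolding g_def
    by (intro holomorphic_intros holomorphic_on_compose_gen[OF _ f, unfolded o_def])
      (auto simp: norm_mult)
  have K: "(1 - (cmod (complex_of_real r))\<^sup>2) / (cmod (cis s - of_real r))\<^sup>2 = poisson_kernel r s" for s
    unfolding cmod_cis_minus poisson_kernel_def by simp
  have gU: "cmod (g (cis s)) = U s" for s
    by (simp add: g_def U_def F_def norm_power cis_mult add.commute)
  have hi: "((\<lambda>s. of_real (poisson_kernel r s) * g (cis s)) has_integral 2 * of_real pi * g (of_real r)) {0..2*pi}"
    using poisson_circle[OF g R, of "of_real r"] r unfolding K by simp
  have "norm (integral {0..2*pi} (\<lambda>s. of_real (poisson_kernel r s) * g (cis s)))
      \<le> integral {0..2*pi} (\<lambda>s. poisson_kernel r s * U s)"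
  proof (rule Henstock_Kurzweil_Integration.integral_norm_bound_integral)
    show "(\<lambda>s. of_real (poisson_kernel r s) * g (cis s)) integrable_on {0..2*pi}"
      using hi by blast
    show "(\<lambda>s. poisson_kernel r s * U s) integrable_on {0..2*pi}"
      by (intro integrable_continuous_real continuous_intros continuous_on_poisson_kernel r U)
    show "norm (of_real (poisson_kernel r s) * g (cis s)) \<le> poisson_kernel r s * U s" for s
      using poisson_kernel_pos[OF r, of s] by (simp add: norm_mult gU)
  qed
  then have "2 * pi * cmod (g (of_real r)) \<le> integral {0..2*pi} (\<lambda>s. poisson_kernel r s * U s)"
    unfolding integral_unique[OF hi] by (simp add: norm_mult)
  also have "\<dots> = integral {0..pi} (\<lambda>s. poisson_kernel r s * U s + poisson_kernel r (-s) * U (-s))"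
  proof (rule integral_period_fold)
    show "continuous_on UNIV (\<lambda>s. poisson_kernel r s * U s)"
      by (intro continuous_intros continuous_on_poisson_kernel r U)
    have "cis (s + 2*pi + t) = cis (s + t)" for s
      by (simp add: cis_mult[symmetric])
    then show "poisson_kernel r (s + 2*pi) * U (s + 2*pi) = poisson_kernel r s * U s" for s
      by (simp add: poisson_kernel_def U_def F_def)
  qed
  also have "\<dots> = integral {0..pi} (\<lambda>s. poisson_kernel r s * (U s + U (-s)))"
    by (simp add: distrib_left)
  also have "\<dots> \<le> 2 * pi * \<beta>"
  proof (rule poisson_kernel_average_le[OF r])
    show "continuous_on {0..pi} (\<lambda>s. U s + U (-s))"
      by (intro continuous_intros U Um)
    fix h :: real assume h: "0 < h" "h \<le> pi"
    have "integral {0..h} (\<lambda>s. U s + U (-s)) = integral {0..h} U + integral {0..h} (\<lambda>s. U (-s))"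
      by (intro Henstock_Kurzweil_Integration.integral_add integrable_continuous_real U Um)
    also have "integral {0..h} (\<lambda>s. U (-s)) = integral {-h..0} U"
      using Henstock_Kurzweil_Integration.integral_reflect_real[of 0 "- h" U] by simp
    also have "integral {0..h} U + integral {-h..0} U = integral {-h..h} U"
      using Henstock_Kurzweil_Integration.integral_combine[of "-h" 0 h U] h
        integrable_continuous_real[OF U, of "-h" h] by simp
    also have "\<dots> = integral {t-h..t+h} F"
      using integral_shift_real_ivl[of "t-h" t "t+h" F] by (simp add: U_def[abs_def])
    also have "\<dots> \<le> 2 * h * \<beta>"
      unfolding F_def using h by (rule avg)
    finally show "integral {0..h} (\<lambda>s. U s + U (-s)) \<le> 2 * h * \<beta>" .
  qed
  finally have "cmod (g (of_real r)) \<le> \<beta>"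
    by simp
  then show ?thesis
    by (simp add: g_def norm_power mult.commute)
qed

section \<open>Weak-type estimate for functions in the Hardy space\<close>

text \<open>The dilation \<open>F\<close> is holomorphic beyond the closed disc, and
  \<open>f (r * cis t)\<close> is its value at radius \<open>r / \<rho>\<close>. Where that value is
  large, some centred average on the unit circle must be large, so the covering estimate
  applies.\<close>

lemma radial_maximal_weak_type_aux:
  assumes f: "f \<in> H2" and \<beta>: "0 < \<beta>" and \<rho>: "0 < \<rho>" "\<rho> < 1"
  shows "\<exists>V\<in>lmeasurable. {t\<in>{0..2*pi}. \<exists>r\<ge>0. r < \<rho> \<and> \<beta> < (cmod (f (of_real r * cis t)))\<^sup>2} \<subseteq> V \<and>
    measure lebesgue V \<le> 30 * pi / \<beta> * (H2_norm f)\<^sup>2"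
proof -
  let ?A = "{t\<in>{0..2*pi}. \<exists>r\<ge>0. r < \<rho> \<and> \<beta> < (cmod (f (of_real r * cis t)))\<^sup>2}"
  define F where "F z = f (of_real \<rho> * z)" for z
  define u where "u s = (cmod (F (cis s)))\<^sup>2" for s
  have hF: "F holomorphic_on ball 0 (1 / \<rho>)"
    unfolding F_def
    by (intro holomorphic_on_compose_gen[OF _ H2_holo[OF f], unfolded o_def] holomorphic_intros)
      (use \<rho> in \<open>auto simp: norm_mult field_simps\<close>)
  have u: "continuous_on S u" for S
    unfolding u_def F_def
    by (intro continuous_intros continuous_on_circle[OF H2_holo[OF f]]) (use \<rho> in auto)
  have ii: "u integrable_on {x..y}" for x y
    by (intro integrable_continuous_real u)
  have "\<exists>V\<in>lmeasurable. ?A \<subseteq> V \<and> measure lebesgue V \<le> 5 / \<beta> * integral {0-pi..2*pi+pi} u"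
  proof (rule maximal_weak_type[OF u _ \<beta>])
    fix t assume "t \<in> ?A"
    then obtain r where r: "0 \<le> r" "r < \<rho>" "\<beta> < (cmod (f (of_real r * cis t)))\<^sup>2"
      by blast
    have "\<not> (cmod (F (of_real (r / \<rho>) * cis t)))\<^sup>2 \<le> \<beta>"
      using r \<rho> by (simp add: F_def)
    moreover have "0 \<le> r / \<rho>" "r / \<rho> < 1" "1 < 1 / \<rho>"
      using r \<rho> by auto
    ultimately have "\<not> (\<forall>h>0. h \<le> pi \<longrightarrow> integral {t-h..t+h} u \<le> 2 * h * \<beta>)"
      using cmod_radial_le[OF hF, of "r / \<rho>" t \<beta>] unfolding u_def by blast
    then show "\<exists>h>0. h \<le> pi \<and> 2 * h * \<beta> < integral {t-h..t+h} u"
      by (auto simp: not_le)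
  qed (auto simp: u_def)
  moreover have "5 / \<beta> * integral {0-pi..2*pi+pi} u \<le> 30 * pi / \<beta> * (H2_norm f)\<^sup>2"
  proof -
    have "cis (s + 2*pi) = cis s" for s
      by (simp add: cis_mult[symmetric])
    then have per: "u (s + 2*pi) = u s" for s
      by (simp add: u_def)
    have 1: "integral {-(2*pi)..0} u = integral {0..2*pi} u"
      using integral_shift_real_ivl[of 0 "2*pi" "2*pi" u] by (simp add: per)
    have 2: "integral {2*pi..4*pi} u = integral {0..2*pi} u"
      using integral_shift_real_ivl[of "2*pi" "2*pi" "4*pi" u] by (simp add: per)
    \<comment> \<open>The enlarged interval \<open>{-pi..3*pi}\<close> is put inside three full
      periods, each contributing \<open>2 * pi * sq_mean f \<rho>\<close>. With the factor 5 of the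
      covering estimate this gives the constant 30.\<close>
    have "integral {0-pi..2*pi+pi} u \<le> integral {-(2*pi)..4*pi} u"
      by (rule integral_subset_le) (auto intro: ii simp: u_def)
    also have "\<dots> = integral {-(2*pi)..0} u + integral {0..4*pi} u"
      by (rule Henstock_Kurzweil_Integration.integral_combine[symmetric]) (auto intro: ii)
    also have "integral {0..4*pi} u = integral {0..2*pi} u + integral {2*pi..4*pi} u"
      by (rule Henstock_Kurzweil_Integration.integral_combine[symmetric]) (auto intro: ii)
    also have "integral {-(2*pi)..0} u + (integral {0..2*pi} u + integral {2*pi..4*pi} u) = 6 * pi * sq_mean f \<rho>"
      unfolding 1 2 by (simp add: sq_mean_def u_def[abs_def] F_def)
    also have "\<dots> \<le> 6 * pi * (H2_norm f)\<^sup>2"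
      using \<rho> by (intro mult_left_mono sq_mean_le_H2_norm f) auto
    finally have "5 / \<beta> * integral {0-pi..2*pi+pi} u \<le> 5 / \<beta> * (6 * pi * (H2_norm f)\<^sup>2)"
      using \<beta> by (intro mult_left_mono) auto
    then show ?thesis
      by (simp add: field_simps)
  qed
  ultimately show ?thesis
    using order_trans by blast
qed

text \<open>The sets \<open>S n\<close> for radii below \<open>\<rho> n\<close> increase to
  \<open>A\<close>. Each is an interval intersected with an open set and hence measurable, so the
  bound passes from its cover to \<open>S n\<close> itself and then to the union.\<close>

lemma radial_maximal_weak_type:
  assumes f: "f \<in> H2" and \<beta>: "0 < \<beta>"
  defines "A \<equiv> {t\<in>{0..2*pi}. \<exists>r\<ge>0. r < 1 \<and> \<beta> < (cmod (f (of_real r * cis t)))\<^sup>2}"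
  shows "A \<in> lmeasurable" and "measure lebesgue A \<le> 30 * pi / \<beta> * (H2_norm f)\<^sup>2"
proof -
  define \<rho> where "\<rho> n = 1 - 1 / (real n + 2)" for n
  define S where "S n = {t\<in>{0..2*pi}. \<exists>r\<ge>0. r < \<rho> n \<and> \<beta> < (cmod (f (of_real r * cis t)))\<^sup>2}" for n
  have \<rho>: "0 < \<rho> n" "\<rho> n < 1" for n
    by (auto simp: \<rho>_def field_simps)
  have mono: "S i \<subseteq> S n" if "i \<le> n" for i n
  proof -
    have "\<rho> i \<le> \<rho> n"
      using that by (simp add: \<rho>_def frac_le)
    then show ?thesis
      unfolding S_def by fastforce
  qed
  have meas: "S n \<in> lmeasurable" for n
  proof -
    have eq: "S n = {0..2*pi} \<inter> (\<Union>r\<in>{0..<\<rho> n}. {t. \<beta> < (cmod (f (of_real r * cis t)))\<^sup>2})"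
      by (auto simp: S_def)
    have "open (\<Union>r\<in>{0..<\<rho> n}. {t. \<beta> < (cmod (f (of_real r * cis t)))\<^sup>2})"
    proof (intro open_UN ballI open_Collect_less)
      fix r assume "r \<in> {0..<\<rho> n}"
      then have r: "0 \<le> r" "r < 1"
        using \<rho>[of n] by auto
      show "continuous_on UNIV (\<lambda>t. (cmod (f (of_real r * cis t)))\<^sup>2)"
        by (intro continuous_intros continuous_on_circle[OF H2_holo[OF f] r])
    qed (intro continuous_intros)
    then have "S n \<in> sets lebesgue"
      unfolding eq by (intro sets.Int) (auto simp: lebesgue_openin)
    moreover have "bounded (S n)"
      by (rule bounded_subset[OF bounded_closed_interval[of 0 "2*pi"]]) (auto simp: S_def)
    ultimately show ?thesis
      by (rule bounded_set_imp_lmeasurable[rotated])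
  qed
  have bound: "measure lebesgue (\<Union>i\<le>n. S i) \<le> 30 * pi / \<beta> * (H2_norm f)\<^sup>2" for n
  proof -
    have "(\<Union>i\<le>n. S i) = S n"
      using mono by blast
    moreover obtain V where "V \<in> lmeasurable" "S n \<subseteq> V" "measure lebesgue V \<le> 30 * pi / \<beta> * (H2_norm f)\<^sup>2"
      using radial_maximal_weak_type_aux[OF f \<beta> \<rho>, of n] unfolding S_def by blast
    ultimately show ?thesis
      using measure_mono_fmeasurable[of "S n" V lebesgue] meas[of n] by (simp add: fmeasurableD)
  qed
  have "A = (\<Union>n. S n)"
  proof
    show "A \<subseteq> (\<Union>n. S n)"
    proof
      fix t assume "t \<in> A"
      then obtain r where r: "t \<in> {0..2*pi}" "0 \<le> r" "r < 1" "\<beta> < (cmod (f (of_real r * cis t)))\<^sup>2"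
        unfolding A_def by blast
      obtain n where "1 / (1 - r) < real n"
        using reals_Archimedean2 by blast
      then have "1 / (real n + 2) < 1 - r"
        using r by (simp add: field_simps)
      then have "r < \<rho> n"
        by (simp add: \<rho>_def)
      then show "t \<in> (\<Union>n. S n)"
        using r unfolding S_def by blast
    qed
    show "(\<Union>n. S n) \<subseteq> A"
      unfolding S_def A_def using \<rho>(2) order_less_trans by fast
  qed
  then show "A \<in> lmeasurable" "measure lebesgue A \<le> 30 * pi / \<beta> * (H2_norm f)\<^sup>2"
    using fmeasurable_countable_Union[OF meas bound] measure_countable_Union_le[OF meas bound] by simp_all
qed

text \<open>The values along one sequence tending to 1 form a Cauchy sequence, and the bound on the
  oscillation transfers its limit to the whole left neighbourhood.\<close>

lemma convergent_at_left_if_Cauchy: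
  fixes f :: "real \<Rightarrow> complex"
  assumes C: "\<And>e. 0 < e \<Longrightarrow> \<exists>d<1. \<forall>r s. d < r \<and> r < 1 \<and> d < s \<and> s < 1 \<longrightarrow> cmod (f r - f s) \<le> e"
  shows "\<exists>L. (f \<longlongrightarrow> L) (at_left 1)"
proof -
  define \<rho> where "\<rho> n = 1 - 1 / (real n + 2)" for n
  have \<rho>1: "\<rho> n < 1" for n
    by (simp add: \<rho>_def)
  have \<rho>: "\<rho> \<longlonglongrightarrow> 1"
    unfolding \<rho>_def by real_asymp
  have ev: "\<exists>N. \<forall>n\<ge>N. d < \<rho> n" if "d < 1" for d
    using order_tendstoD(1)[OF \<rho> that] by (simp add: eventually_sequentially)
  have "Cauchy (\<lambda>n. f (\<rho> n))"
  proof (rule metric_CauchyI)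
    fix e :: real assume "0 < e"
    then obtain d where d: "d < 1" "\<And>r s. d < r \<Longrightarrow> r < 1 \<Longrightarrow> d < s \<Longrightarrow> s < 1 \<Longrightarrow> cmod (f r - f s) \<le> e / 2"
      using C[of "e / 2"] by auto
    then obtain N where N: "\<And>n. n \<ge> N \<Longrightarrow> d < \<rho> n"
      using ev by blast
    have "dist (f (\<rho> m)) (f (\<rho> n)) < e" if "m \<ge> N" "n \<ge> N" for m n
      using d(2)[OF N[OF that(1)] \<rho>1 N[OF that(2)] \<rho>1] \<open>0 < e\<close> by (simp add: dist_norm)
    then show "\<exists>M. \<forall>m\<ge>M. \<forall>n\<ge>M. dist (f (\<rho> m)) (f (\<rho> n)) < e"
      by blast
  qed
  then obtain L where L: "(\<lambda>n. f (\<rho> n)) \<longlonglongrightarrow> L"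
    using Cauchy_convergent_iff convergent_def by blast
  have "(f \<longlongrightarrow> L) (at_left 1)"
  proof (rule tendstoI)
    fix e :: real assume "0 < e"
    then obtain d where d: "d < 1" "\<And>r s. d < r \<Longrightarrow> r < 1 \<Longrightarrow> d < s \<Longrightarrow> s < 1 \<Longrightarrow> cmod (f r - f s) \<le> e / 2"
      using C[of "e / 2"] by auto
    then obtain N where N: "\<And>n. n \<ge> N \<Longrightarrow> d < \<rho> n"
      using ev by blast
    have "dist (f r) L < e" if r: "d < r" "r < 1" for r
    proof -
      have "(\<lambda>n. cmod (f r - f (\<rho> n))) \<longlonglongrightarrow> cmod (f r - L)"
        by (intro tendsto_intros L)
      then have "cmod (f r - L) \<le> e / 2"
        by (rule LIMSEQ_le_const2) (use d(2)[OF r] N \<rho>1 in blast)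
      then show ?thesis
        using \<open>0 < e\<close> by (simp add: dist_norm)
    qed
    then show "\<forall>\<^sub>F r in at_left 1. dist (f r) L < e"
      unfolding eventually_at_left_field using d(1) by blast
  qed
  then show ?thesis ..
qed

section \<open>Radial limits\<close>

text \<open>\<open>f\<close> is split into a Taylor polynomial, which has radial limits everywhere,
  and a remainder of small norm. Oscillation of \<open>f\<close> along a radius forces the remainder
  to be large somewhere on it, which by the maximal estimate happens only on a set of small
  measure.\<close>

theorem fatou_radial_limits:
  assumes f: "f \<in> H2"
  shows "negligible {t\<in>{0..2*pi}. \<not> (\<exists>L. ((\<lambda>r. f (of_real r * cis t)) \<longlongrightarrow> L) (at_left 1))}"
    (is "negligible ?N")
proof -
  \<comment> \<open>These are the angles whose radii carry oscillation above \<open>e\<close>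
    arbitrarily close to the circle; for \<open>e = 1 / (n + 1)\<close> they cover the exceptional
    set.\<close>
  define bad where "bad e = {t\<in>{0..2*pi}. \<forall>d<1. \<exists>r s. d < r \<and> r < 1 \<and> d < s \<and> s < 1 \<and>
      e < cmod (f (of_real r * cis t) - f (of_real s * cis t))}" for e
  have neg: "negligible (bad e)" if e: "0 < e" for e
    unfolding negligible_outer_le
  proof (intro allI impI)
    fix \<epsilon> :: real assume \<epsilon>: "0 < \<epsilon>"
    let ?g = "\<lambda>N z. f z - taylor_poly f N z"
    \<comment> \<open>An oscillation above \<open>e\<close> is shared by two values of the remainder
      and two increments of the polynomial. Each increment is below \<open>e/4\<close>, so one value
      of the remainder exceeds \<open>e/4\<close>.\<close>
    let ?\<beta> = "(e/4)\<^sup>2"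
    have "(\<lambda>N. 30 * pi / ?\<beta> * (H2_norm (?g N))\<^sup>2) \<longlonglongrightarrow> 30 * pi / ?\<beta> * 0\<^sup>2"
      by (intro tendsto_intros H2_norm_minus_taylor_poly_tendsto_0 f)
    then have "\<forall>\<^sub>F N in sequentially. 30 * pi / ?\<beta> * (H2_norm (?g N))\<^sup>2 < \<epsilon>"
      using \<epsilon> by (intro order_tendstoD(2)[where y = "30 * pi / ?\<beta> * 0\<^sup>2"]) auto
    then obtain N where N: "30 * pi / ?\<beta> * (H2_norm (?g N))\<^sup>2 < \<epsilon>"
      by (meson eventually_happens sequentially_bot)
    let ?A = "{t\<in>{0..2*pi}. \<exists>r\<ge>0. r < 1 \<and> ?\<beta> < (cmod (?g N (of_real r * cis t)))\<^sup>2}"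
    have gH2: "?g N \<in> H2"
      by (intro H2_diff f H2_taylor_poly)
    have \<beta>: "0 < ?\<beta>"
      using e by simp
    have "bad e \<subseteq> ?A"
    proof
      fix t assume t: "t \<in> bad e"
      let ?p = "\<lambda>r::real. taylor_poly f N (of_real r * cis t)"
      have "(?p \<longlongrightarrow> ?p 1) (at_left 1)"
        unfolding taylor_poly_def by (intro tendsto_intros)
      then have "\<forall>\<^sub>F r in at_left 1. dist (?p r) (?p 1) < e / 4"
        using e by (intro tendstoD) auto
      then obtain d where d: "d < 1" "\<And>r. d < r \<Longrightarrow> r < 1 \<Longrightarrow> dist (?p r) (?p 1) < e / 4"
        unfolding eventually_at_left_field by blast
      \<comment> \<open>The maximum with 0 keeps the radii nonnegative, as membership in
        \<open>?A\<close> demands.\<close>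
      have "max d 0 < 1"
        using d by simp
      then obtain r s where rs: "max d 0 < r" "r < 1" "max d 0 < s" "s < 1"
          "e < cmod (f (of_real r * cis t) - f (of_real s * cis t))"
        using t unfolding bad_def by blast
      let ?gr = "?g N (of_real r * cis t)" and ?gs = "?g N (of_real s * cis t)"
      have "f (of_real r * cis t) - f (of_real s * cis t) = ?gr - ?gs + ((?p r - ?p 1) - (?p s - ?p 1))"
        by simp
      then have "cmod (f (of_real r * cis t) - f (of_real s * cis t)) \<le>
          cmod (?gr - ?gs) + cmod ((?p r - ?p 1) - (?p s - ?p 1))"
        by (metis norm_triangle_ineq)
      also have "\<dots> \<le> (cmod ?gr + cmod ?gs) + (cmod (?p r - ?p 1) + cmod (?p s - ?p 1))"
        by (intro add_mono norm_triangle_ineq4)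
      finally have "e / 4 < cmod ?gr \<or> e / 4 < cmod ?gs"
        using d(2)[of r] d(2)[of s] rs unfolding dist_norm by linarith
      then have "?\<beta> < (cmod ?gr)\<^sup>2 \<or> ?\<beta> < (cmod ?gs)\<^sup>2"
        using e by (auto intro!: power_strict_mono)
      moreover have "0 \<le> r" "0 \<le> s" "t \<in> {0..2*pi}"
        using t rs unfolding bad_def by auto
      ultimately show "t \<in> ?A"
        using rs(2,4) by blast
    qed
    moreover have "?A \<in> lmeasurable" "measure lebesgue ?A \<le> \<epsilon>"
      using radial_maximal_weak_type[OF gH2 \<beta>] N by linarith+
    ultimately show "\<exists>T. bad e \<subseteq> T \<and> T \<in> lmeasurable \<and> measure lebesgue T \<le> \<epsilon>"
      by blast
  qed
  have "negligible (\<Union>n. bad (1 / (real n + 1)))"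
    by (intro negligible_countable_Union) (auto intro!: neg)
  moreover have "?N \<subseteq> (\<Union>n. bad (1 / (real n + 1)))"
  proof
    fix t assume t: "t \<in> ?N"
    then have "\<not> (\<forall>e>0. \<exists>d<1. \<forall>r s. d < r \<and> r < 1 \<and> d < s \<and> s < 1 \<longrightarrow>
        cmod (f (of_real r * cis t) - f (of_real s * cis t)) \<le> e)"
      using convergent_at_left_if_Cauchy[of "\<lambda>r. f (of_real r * cis t)"] by blast
    then obtain e where e: "0 < e" "\<And>d. d < 1 \<Longrightarrow> \<exists>r s. d < r \<and> r < 1 \<and> d < s \<and> s < 1 \<and>
        e < cmod (f (of_real r * cis t) - f (of_real s * cis t))"
      unfolding not_le[symmetric] by blast
    obtain n where n: "1 / (real n + 1) < e"
      using reals_Archimedean[OF e(1)] by (auto simp: inverse_eq_divide add.commute)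
    have "t \<in> bad (1 / (real n + 1))"
      unfolding bad_def using t e(2) n by (blast intro: order_less_trans)
    then show "t \<in> (\<Union>n. bad (1 / (real n + 1)))"
      by blast
  qed
  ultimately show ?thesis
    by (rule negligible_subset)
qed

lemma boundary_value_eqI:
  "((\<lambda>r. f (of_real r * \<zeta>)) \<longlongrightarrow> L) (at_left 1) \<Longrightarrow> boundary_value f \<zeta> = L"
  unfolding boundary_value_def by (intro tendsto_Lim) auto

text \<open>All functions are set to 0 on \<open>N\<close>, which leaves integrability and the
  integrals unchanged.\<close>

lemma dominated_convergence_negligible:
  fixes f :: "nat \<Rightarrow> 'a::euclidean_space \<Rightarrow> 'b::euclidean_space"
  assumes f: "\<And>k. f k integrable_on S" and h: "h integrable_on S" and N: "negligible N"
    and le: "\<And>k x. x \<in> S - N \<Longrightarrow> norm (f k x) \<le> h x"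
    and conv: "\<And>x. x \<in> S - N \<Longrightarrow> (\<lambda>k. f k x) \<longlonglongrightarrow> g x"
  shows "g integrable_on S" and "(\<lambda>k. integral S (f k)) \<longlonglongrightarrow> integral S g"
proof -
  let ?f = "\<lambda>k x. if x \<in> N then 0 else f k x" and ?g = "\<lambda>x. if x \<in> N then 0 else g x"
  let ?h = "\<lambda>x. if x \<in> N then 0 else h x"
  have f': "?f k integrable_on S" for k
    by (rule integrable_spike[OF f N]) auto
  have h': "?h integrable_on S"
    by (rule integrable_spike[OF h N]) auto
  have le': "norm (?f k x) \<le> ?h x" if "x \<in> S" for k x
    using le that by simp
  have conv': "(\<lambda>k. ?f k x) \<longlonglongrightarrow> ?g x" if "x \<in> S" for x
    using conv that by simp
  note dc = dominated_convergence[OF f' h' le' conv']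
  show "g integrable_on S"
    by (rule integrable_spike[OF dc(1) N]) auto
  have "integral S (?f k) = integral S (f k)" for k
    by (rule integral_spike[OF N]) auto
  moreover have "integral S ?g = integral S g"
    by (rule integral_spike[OF N]) auto
  ultimately show "(\<lambda>k. integral S (f k)) \<longlonglongrightarrow> integral S g"
    using dc(2) by simp
qed

lemma H2_if_bounded:
  assumes f: "f holomorphic_on ball 0 1" and le: "\<And>z. z \<in> ball 0 1 \<Longrightarrow> cmod (f z) \<le> C"
  shows "f \<in> H2"
proof -
  have 1: "(\<lambda>z. 1) \<in> H2"
    using H2_power[of 0] by simp
  show ?thesis
  proof (rule H2I[OF f])
    fix r :: real assume r: "0 \<le> r" "r < 1"
    show "sq_mean f r \<le> C\<^sup>2 * sq_mean (\<lambda>z. 1) 0"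
      using sq_mean_mult_le[OF f le, of "\<lambda>z. 1" r] r by (simp add: sq_mean_def)
  qed
qed

section \<open>Norms of powers as boundary integrals\<close>

context
  fixes v :: "complex \<Rightarrow> complex"
  assumes v: "v holomorphic_on ball 0 1" and v1: "\<And>z. z \<in> ball 0 1 \<Longrightarrow> cmod (v z) \<le> 1"
begin

lemma unit_ball_power_H2: "(\<lambda>z. v z ^ m) \<in> H2"
  using v1 by (intro H2_if_bounded[where C = 1] holomorphic_intros v) (auto simp: norm_power power_le_one)

text \<open>Off the null set of Fatou's theorem the radial values converge, and they are bounded by
  1, so dominated convergence gives both integrability of the boundary function and the limit of the
  square means. These increase with the radius, so their limit is their supremum.\<close>

lemma H2_norm_power_boundary:
  shows "(\<lambda>t. cmod (boundary_value v (cis t)) ^ (2*m)) integrable_on {0..2*pi}"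
    and "(H2_norm (\<lambda>z. v z ^ m))\<^sup>2 = integral {0..2*pi} (\<lambda>t. cmod (boundary_value v (cis t)) ^ (2*m)) / (2*pi)"
proof -
  let ?b = "\<lambda>t. cmod (boundary_value v (cis t)) ^ (2*m)"
  define \<rho> where "\<rho> n = 1 - 1 / (real n + 2)" for n
  define F where "F n t = cmod (v (of_real (\<rho> n) * cis t)) ^ (2*m)" for n t
  let ?N = "{t\<in>{0..2*pi}. \<not> (\<exists>L. ((\<lambda>r. v (of_real r * cis t)) \<longlongrightarrow> L) (at_left 1))}"
  have \<rho>: "0 \<le> \<rho> n" "\<rho> n < 1" for n
    by (auto simp: \<rho>_def field_simps)
  have \<rho>lim: "\<rho> \<longlonglongrightarrow> 1"
    unfolding \<rho>_def by real_asymp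
  have \<rho>left: "filterlim \<rho> (at_left 1) sequentially"
    using \<rho>lim \<rho>(2) unfolding filterlim_at by (auto simp: less_imp_neq)
  have N: "negligible ?N"
    by (rule fatou_radial_limits) (use unit_ball_power_H2[of 1] in simp)
  have Fint: "F n integrable_on {0..2*pi}" for n
    unfolding F_def by (intro integrable_continuous_real continuous_intros continuous_on_circle v \<rho>)
  have Fle: "norm (F n t) \<le> 1" for n t
    unfolding F_def using v1[OF circle_in_ball[OF \<rho>]] by (simp add: power_le_one)
  have Flim: "(\<lambda>n. F n t) \<longlonglongrightarrow> ?b t" if "t \<in> {0..2*pi} - ?N" for t
  proof -
    obtain L where L: "((\<lambda>r. v (of_real r * cis t)) \<longlongrightarrow> L) (at_left 1)"
      using \<open>t \<in> _\<close> by blast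
    have "(\<lambda>n. v (of_real (\<rho> n) * cis t)) \<longlonglongrightarrow> L"
      by (rule filterlim_compose[OF L \<rho>left])
    then show ?thesis
      unfolding F_def boundary_value_eqI[OF L] by (intro tendsto_intros)
  qed
  have one: "(\<lambda>t::real. 1::real) integrable_on {0..2*pi}"
    by (rule integrable_const_ivl)
  show int: "?b integrable_on {0..2*pi}"
    by (rule dominated_convergence_negligible(1)[OF Fint one N Fle Flim])
  have "(\<lambda>n. integral {0..2*pi} (F n)) \<longlonglongrightarrow> integral {0..2*pi} ?b"
    by (rule dominated_convergence_negligible(2)[OF Fint one N Fle Flim])
  then have "(\<lambda>n. integral {0..2*pi} (F n) / (2*pi)) \<longlonglongrightarrow> integral {0..2*pi} ?b / (2*pi)"
    by (intro tendsto_intros) auto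
  moreover have "integral {0..2*pi} (F n) / (2*pi) = sq_mean (\<lambda>z. v z ^ m) (\<rho> n)" for n
    unfolding sq_mean_def F_def by (simp add: norm_power power_mult mult.commute[of 2])
  ultimately have lim: "(\<lambda>n. sq_mean (\<lambda>z. v z ^ m) (\<rho> n)) \<longlonglongrightarrow> integral {0..2*pi} ?b / (2*pi)"
    by simp
  show "(H2_norm (\<lambda>z. v z ^ m))\<^sup>2 = integral {0..2*pi} ?b / (2*pi)"
  proof (rule antisym)
    show "integral {0..2*pi} ?b / (2*pi) \<le> (H2_norm (\<lambda>z. v z ^ m))\<^sup>2"
      by (rule LIMSEQ_le_const2[OF lim]) (use sq_mean_le_H2_norm[OF unit_ball_power_H2] \<rho> in blast)
    have b0: "0 \<le> integral {0..2*pi} ?b / (2*pi)"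
      by (rule LIMSEQ_le_const[OF lim]) (use sq_mean_nonneg in blast)
    have "H2_norm (\<lambda>z. v z ^ m) \<le> sqrt (integral {0..2*pi} ?b / (2*pi))"
    proof (rule H2_norm_le)
      fix r :: real assume r: "0 \<le> r" "r < 1"
      have "\<forall>\<^sub>F n in sequentially. r < \<rho> n"
        using order_tendstoD(1)[OF \<rho>lim r(2)] .
      then have "\<forall>\<^sub>F n in sequentially. sq_mean (\<lambda>z. v z ^ m) r \<le> sq_mean (\<lambda>z. v z ^ m) (\<rho> n)"
        by eventually_elim (intro sq_mean_mono H2_holo unit_ball_power_H2; use r \<rho> in auto)
      then have "sq_mean (\<lambda>z. v z ^ m) r \<le> integral {0..2*pi} ?b / (2*pi)"
        using tendsto_lowerbound[OF lim] by simp
      then show "sq_mean (\<lambda>z. v z ^ m) r \<le> (sqrt (integral {0..2*pi} ?b / (2*pi)))\<^sup>2"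
        using b0 by simp
    qed (use b0 in simp)
    then have "(H2_norm (\<lambda>z. v z ^ m))\<^sup>2 \<le> (sqrt (integral {0..2*pi} ?b / (2*pi)))\<^sup>2"
      by (intro power_mono H2_norm_nonneg unit_ball_power_H2)
    then show "(H2_norm (\<lambda>z. v z ^ m))\<^sup>2 \<le> integral {0..2*pi} ?b / (2*pi)"
      using b0 by simp
  qed
qed

text \<open>The boundary integrand \<open>?b t ^ (2*m)\<close> tends to 0 off a null set and is at
  most 1 there, so dominated convergence applies.\<close>

lemma H2_norm_power_tendsto_0:
  assumes "AE t in lebesgue_on {0..2*pi}. cmod (boundary_value v (cis t)) < 1"
  shows "(\<lambda>m. H2_norm (\<lambda>z. v z ^ m)) \<longlonglongrightarrow> 0"
proof -
  let ?b = "\<lambda>t. cmod (boundary_value v (cis t))"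
  have "AE t in lebesgue. t \<in> {0..2*pi} \<longrightarrow> ?b t < 1"
    using assms by (subst (asm) AE_restrict_space_iff) auto
  then obtain N where N: "{t \<in> space lebesgue. \<not> (t \<in> {0..2*pi} \<longrightarrow> ?b t < 1)} \<subseteq> N"
      "emeasure lebesgue N = 0" "N \<in> sets lebesgue"
    by (rule AE_E)
  have neg: "negligible N"
    using N(2,3) by (simp add: negligible_iff_null_sets null_sets_def)
  have lt: "?b t < 1" if "t \<in> {0..2*pi} - N" for t
    using that N(1) by auto
  have "(\<lambda>m. integral {0..2*pi} (\<lambda>t. ?b t ^ (2*m))) \<longlonglongrightarrow> integral {0..2*pi} (\<lambda>t. 0)"
  proof (rule dominated_convergence_negligible(2)[OF H2_norm_power_boundary(1) _ neg])
    show "(\<lambda>t::real. 1::real) integrable_on {0..2*pi}"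
      by (rule integrable_const_ivl)
    fix t assume t: "t \<in> {0..2*pi} - N"
    show "norm (?b t ^ (2*m)) \<le> 1" for m
      using lt[OF t] by (simp add: power_le_one)
    have "(\<lambda>m. ((?b t)\<^sup>2) ^ m) \<longlonglongrightarrow> 0"
      using lt[OF t] by (intro LIMSEQ_realpow_zero) (auto simp: power_less_one_iff abs_square_less_1)
    then show "(\<lambda>m. ?b t ^ (2*m)) \<longlonglongrightarrow> 0"
      by (simp add: power_mult)
  qed
  then have "(\<lambda>m. integral {0..2*pi} (\<lambda>t. ?b t ^ (2*m)) / (2*pi)) \<longlonglongrightarrow> 0 / (2*pi)"
    by (intro tendsto_intros) auto
  then have "(\<lambda>m. (H2_norm (\<lambda>z. v z ^ m))\<^sup>2) \<longlonglongrightarrow> 0"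
    by (simp add: H2_norm_power_boundary(2))
  from tendsto_real_sqrt[OF this] show ?thesis
    by (simp add: H2_norm_nonneg unit_ball_power_H2)
qed

text \<open>For every \<open>m\<close> the boundary integrand equals 1 on \<open>E\<close>, so
  \<open>E\<close> alone contributes its full measure.\<close>

lemma H2_norm_power_lower_bound:
  assumes E: "E \<in> sets lebesgue" "E \<subseteq> {0..2*pi}"
    and b: "\<And>t. t \<in> E \<Longrightarrow> cmod (boundary_value v (cis t)) = 1"
  shows "measure lebesgue E / (2*pi) \<le> (H2_norm (\<lambda>z. v z ^ m))\<^sup>2"
proof -
  let ?b = "\<lambda>t. cmod (boundary_value v (cis t)) ^ (2*m)"
  have E': "E \<in> lmeasurable"
    by (rule bounded_set_imp_lmeasurable[OF bounded_subset[OF bounded_closed_interval E(2)] E(1)])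
  have "measure lebesgue E = integral E (\<lambda>t. 1)"
    by (rule lmeasure_integral[OF E'])
  also have "\<dots> = integral E ?b"
    by (rule Henstock_Kurzweil_Integration.integral_cong) (simp add: b)
  also have "\<dots> \<le> integral {0..2*pi} ?b"
  proof (rule integral_subset_le[OF E(2) _ H2_norm_power_boundary(1)])
    have "(\<lambda>t. 1::real) integrable_on E"
      using E' by (simp add: lmeasurable_iff_integrable_on)
    then show "?b integrable_on E"
      by (rule integrable_eq) (simp add: b)
  qed simp
  finally show ?thesis
    unfolding H2_norm_power_boundary(2) by (intro divide_right_mono) auto
qed

end

section \<open>Weighted rotations\<close>

lemma weakly_convergesD:
  "weakly_converges A L \<Longrightarrow> \<psi> \<in> hardy2_dual \<Longrightarrow> (\<lambda>n. \<psi> (A n f)) \<longlonglongrightarrow> \<psi> (L f)"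
  by (simp add: weakly_converges_def)

lemma strongly_imp_weakly:
  assumes "strongly_converges A L"
  shows "weakly_converges A L"
  unfolding weakly_converges_def
proof (intro allI ballI)
  fix f \<psi> assume "\<psi> \<in> hardy2_dual"
  then have "bounded_linear \<psi>"
    by (simp add: hardy2_dual_def)
  moreover have "(\<lambda>n. A n f) \<longlonglongrightarrow> L f"
    using assms by (simp add: strongly_converges_def)
  ultimately show "(\<lambda>n. \<psi> (A n f)) \<longlonglongrightarrow> \<psi> (L f)"
    by (rule bounded_linear.tendsto)
qed

text \<open>Point evaluations are continuous functionals and separate the elements of the space.
  This is what identifies an arbitrary limit \<open>L\<close> with the known limit 0.\<close>

lemma weak_limit_unique:
  assumes "weakly_converges A L" "weakly_converges A M"
  shows "L = M"
proof
  fix f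
  show "L f = M f"
  proof (rule hardy2_eqI)
    fix z :: complex assume "z \<in> ball 0 1"
    then have "(\<lambda>n. hardy2_fun (A n f) z) \<longlonglongrightarrow> hardy2_fun (L f) z"
        "(\<lambda>n. hardy2_fun (A n f) z) \<longlonglongrightarrow> hardy2_fun (M f) z"
      by (rule weakly_convergesD[OF assms(1) point_evaluation_dual],
          rule weakly_convergesD[OF assms(2) point_evaluation_dual])
    then show "hardy2_fun (L f) z = hardy2_fun (M f) z"
      by (rule LIMSEQ_unique)
  qed
qed

locale rotation_weight =
  fixes w v :: "complex \<Rightarrow> complex" and \<mu> :: complex and k :: nat
  assumes w: "w \<in> H_inf"
    and mu: "primitive_root_of_unity k \<mu>"
    and v: "\<And>z. z \<in> ball 0 1 \<Longrightarrow> v z = (\<Prod>j<k. w (\<mu> ^ j * z))"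
begin

abbreviation "Tw \<equiv> wcomp w (\<lambda>z. \<mu> * z)"
abbreviation "nv \<equiv> H_inf_norm v"

lemma k_pos: "0 < k"
  using mu unfolding primitive_root_of_unity_def by blast

lemma mu_power_k: "\<mu> ^ k = 1"
  using mu unfolding primitive_root_of_unity_def by blast

lemma cmod_mu: "cmod \<mu> = 1"
proof -
  have "cmod \<mu> ^ k = 1 ^ k"
    using mu_power_k norm_power[of \<mu> k] by simp
  then show ?thesis
    by (rule power_eq_imp_eq_base) (use k_pos in auto)
qed

lemma rotate_in_ball: "z \<in> ball 0 1 \<Longrightarrow> \<mu> ^ j * z \<in> ball 0 1"
  by (simp add: norm_mult norm_power cmod_mu)

lemma v_holo: "v holomorphic_on ball 0 1"
proof -
  have w_holo: "w holomorphic_on ball 0 1"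
    using w by (simp add: H_inf_def)
  have "(\<lambda>z. w (\<mu> ^ j * z)) holomorphic_on ball 0 1" for j
  proof (rule holomorphic_on_compose_gen[OF _ w_holo, unfolded o_def])
    show "(\<lambda>z. \<mu> ^ j * z) ` ball 0 1 \<subseteq> ball 0 1"
      using rotate_in_ball by blast
  qed (intro holomorphic_intros)
  then have "(\<lambda>z. \<Prod>j<k. w (\<mu> ^ j * z)) holomorphic_on ball 0 1"
    by (rule holomorphic_on_prod)
  then show ?thesis
    by (rule holomorphic_transform) (simp add: v)
qed

lemma v_bdd: "bdd_above ((\<lambda>z. cmod (v z)) ` ball 0 1)"
proof -
  obtain C where C: "C \<ge> 0" "\<forall>z\<in>ball 0 1. cmod (w z) \<le> C"
    using wcomp_rotation_bound[OF w cmod_mu] by blast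
  have "cmod (v z) \<le> (\<Prod>j<k. C)" if z: "z \<in> ball 0 1" for z
    unfolding v[OF z] prod_norm[symmetric]
    by (rule prod_mono) (use C(2) rotate_in_ball[OF z] in auto)
  then show ?thesis
    by (rule bdd_aboveI2)
qed

lemma cmod_v_le: "z \<in> ball 0 1 \<Longrightarrow> cmod (v z) \<le> nv"
  unfolding H_inf_norm_def by (rule cSUP_upper[OF _ v_bdd])

lemma q_nonneg: "0 \<le> nv"
  using cmod_v_le[of 0] norm_ge_zero order_trans by (metis centre_in_ball zero_less_one)

lemma less_H_inf_norm_D:
  assumes "c < nv"
  obtains z where "z \<in> ball 0 1" "c < cmod (v z)"
  using assms less_cSUP_iff[OF _ v_bdd, of c] unfolding H_inf_norm_def by auto

section \<open>Powers of the weighted rotation and their norms\<close>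

lemma bounded_linear_T_pow: "bounded_linear (Tw ^^ n)"
proof (induction n)
  case 0
  then show ?case
    by (simp add: id_def bounded_linear_ident)
next
  case (Suc n)
  then show ?case
    using bounded_linear_compose[OF bounded_linear_wcomp[OF w cmod_mu] Suc] by (simp add: o_def)
qed

lemma hardy2_fun_T_pow:
  assumes "z \<in> ball 0 1"
  shows "hardy2_fun ((Tw ^^ n) f) z = (\<Prod>j<n. w (\<mu> ^ j * z)) * hardy2_fun f (\<mu> ^ n * z)"
  using assms
\<comment> \<open>The point is generalized because the outermost \<open>Tw\<close> evaluates the
  remaining power at \<open>\<mu> * z\<close>.\<close>
proof (induction n arbitrary: z)
  case (Suc n)
  have "\<mu> * z \<in> ball 0 1"
    using rotate_in_ball[OF Suc.prems, of 1] by simp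
  from Suc.IH[OF this]
  have "hardy2_fun ((Tw ^^ Suc n) f) z =
      w z * ((\<Prod>j<n. w (\<mu> ^ j * (\<mu> * z))) * hardy2_fun f (\<mu> ^ n * (\<mu> * z)))"
    by (simp only: funpow.simps o_apply hardy2_fun_wcomp[OF w cmod_mu Suc.prems])
  then show ?case
    unfolding prod.lessThan_Suc_shift by (simp add: mult_ac del: funpow.simps)
qed simp

lemma hardy2_fun_T_pow_mult:
  assumes z: "z \<in> ball 0 1"
  shows "hardy2_fun ((Tw ^^ (k * n)) f) z = v z ^ n * hardy2_fun f z"
proof (induction n)
  case (Suc n)
  have "(Tw ^^ (k * Suc n)) f = (Tw ^^ k) ((Tw ^^ (k * n)) f)"
    by (simp add: funpow_add)
  then show ?case
    using Suc hardy2_fun_T_pow[OF z, of k] mu_power_k by (simp add: v[OF z])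
qed simp

lemma norm_T_pow_mult_le: "norm ((Tw ^^ (k * n)) f) \<le> nv ^ n * norm f"
proof -
  have "norm ((Tw ^^ (k * n)) f) = H2_norm (\<lambda>z. v z ^ n * hardy2_fun f z)"
    unfolding norm_hardy2_def by (rule H2_norm_cong) (rule hardy2_fun_T_pow_mult)
  also have "\<dots> \<le> nv ^ n * norm f"
  proof (rule H2_norm_le)
    fix r :: real assume r: "0 \<le> r" "r < 1"
    have "sq_mean (\<lambda>z. v z ^ n * hardy2_fun f z) r \<le> (nv ^ n)\<^sup>2 * sq_mean (hardy2_fun f) r"
    proof (rule sq_mean_mult_le[OF _ _ H2_holo[OF hardy2_fun_H2] r])
      show "(\<lambda>z. v z ^ n) holomorphic_on ball 0 1"
        by (intro holomorphic_intros v_holo)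
      show "cmod (v z ^ n) \<le> nv ^ n" if "z \<in> ball 0 1" for z
        unfolding norm_power by (rule power_mono[OF cmod_v_le[OF that] norm_ge_zero])
    qed
    also have "\<dots> \<le> (nv ^ n)\<^sup>2 * (norm f)\<^sup>2"
      unfolding norm_hardy2_def by (intro mult_left_mono sq_mean_le_H2_norm hardy2_fun_H2 r) auto
    finally show "sq_mean (\<lambda>z. v z ^ n * hardy2_fun f z) r \<le> (nv ^ n * norm f)\<^sup>2"
      by (simp add: power_mult_distrib)
  qed (simp add: q_nonneg)
  finally show ?thesis .
qed

text \<open>With a base of at least 1 the powers increase in the exponent, so one constant bounds
  \<open>Tw ^^ j\<close> for all \<open>j \<le> k\<close>, in particular for the remainders
  \<open>n mod k\<close>.\<close>

abbreviation "bnd \<equiv> (1 + onorm Tw) ^ k"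

lemma onorm_T_nonneg: "0 \<le> onorm Tw"
  by (rule onorm_pos_le[OF bounded_linear_wcomp[OF w cmod_mu]])

lemma B_nonneg: "0 \<le> bnd"
  using onorm_T_nonneg by simp

lemma norm_T_pow_le_B:
  assumes "j \<le> k"
  shows "norm ((Tw ^^ j) f) \<le> bnd * norm f"
proof -
  have "norm ((Tw ^^ j) f) \<le> (1 + onorm Tw) ^ j * norm f"
  proof (induction j)
    case (Suc j)
    have "norm ((Tw ^^ Suc j) f) \<le> onorm Tw * norm ((Tw ^^ j) f)"
      using onorm[OF bounded_linear_wcomp[OF w cmod_mu]] by simp
    also have "\<dots> \<le> (1 + onorm Tw) * norm ((Tw ^^ j) f)"
      by (intro mult_right_mono) auto
    also have "\<dots> \<le> (1 + onorm Tw) * ((1 + onorm Tw) ^ j * norm f)"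
      using onorm_T_nonneg by (intro mult_left_mono Suc.IH) auto
    finally show ?case
      by (simp add: mult_ac)
  qed simp
  also have "\<dots> \<le> bnd * norm f"
    using assms onorm_T_nonneg by (intro mult_right_mono power_increasing) auto
  finally show ?thesis .
qed

lemma T_pow_split: "(Tw ^^ n) f = (Tw ^^ (k * (n div k))) ((Tw ^^ (n mod k)) f)"
  using funpow_add[of "k * (n div k)" "n mod k" Tw] by (simp add: mult_div_mod_eq)

text \<open>The exponent is divided by \<open>k\<close> with remainder: each full cycle contributes
  a factor \<open>nv\<close>, and the remainder at most \<open>bnd\<close>.\<close>

lemma norm_T_pow_le: "norm ((Tw ^^ n) f) \<le> nv ^ (n div k) * bnd * norm f"
proof -
  have "norm ((Tw ^^ n) f) \<le> nv ^ (n div k) * norm ((Tw ^^ (n mod k)) f)"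
    unfolding T_pow_split[of n] by (rule norm_T_pow_mult_le)
  also have "\<dots> \<le> nv ^ (n div k) * (bnd * norm f)"
    using k_pos by (intro mult_left_mono norm_T_pow_le_B) (auto simp: q_nonneg less_imp_le)
  finally show ?thesis
    by simp
qed

lemma filterlim_div_k: "filterlim (\<lambda>n. n div k) sequentially sequentially"
  unfolding filterlim_at_top
proof
  fix Z
  have "Z \<le> n div k" if "n \<ge> Z * k" for n
    using that k_pos by (simp add: less_eq_div_iff_mult_less_eq)
  then show "\<forall>\<^sub>F n in sequentially. Z \<le> n div k"
    unfolding eventually_sequentially by blast
qed

lemma onorm_T_pow_tendsto_0:
  assumes "nv < 1"
  shows "(\<lambda>n. onorm (Tw ^^ n)) \<longlonglongrightarrow> 0"
proof (rule tendsto_sandwich)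
  show "\<forall>\<^sub>F n in sequentially. 0 \<le> onorm (Tw ^^ n)"
    by (intro always_eventually allI onorm_pos_le bounded_linear_T_pow)
  show "\<forall>\<^sub>F n in sequentially. onorm (Tw ^^ n) \<le> nv ^ (n div k) * bnd"
    by (intro always_eventually allI onorm_bound norm_T_pow_le mult_nonneg_nonneg zero_le_power
        q_nonneg B_nonneg)
  have "(\<lambda>n. nv ^ n) \<longlonglongrightarrow> 0"
    using assms q_nonneg by (intro LIMSEQ_realpow_zero) auto
  from filterlim_compose[OF this filterlim_div_k] have "(\<lambda>n. nv ^ (n div k) * bnd) \<longlonglongrightarrow> 0 * bnd"
    by (intro tendsto_intros)
  then show "(\<lambda>n. nv ^ (n div k) * bnd) \<longlonglongrightarrow> 0"
    by simp
qed simp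

lemma hardy2_fun_T_pow_one:
  "z \<in> ball 0 1 \<Longrightarrow> hardy2_fun ((Tw ^^ (k * n)) (hmonom 0)) z = v z ^ n"
  by (simp add: hardy2_fun_T_pow_mult hardy2_fun_hmonom del: mem_ball)

lemma norm_T_pow_one: "norm ((Tw ^^ (k * n)) (hmonom 0)) = H2_norm (\<lambda>z. v z ^ n)"
  unfolding norm_hardy2_def by (rule H2_norm_cong) (rule hardy2_fun_T_pow_one)

lemma subseq_mult_k: "strict_mono (\<lambda>n. k * n)"
  using k_pos by (simp add: strict_mono_def)

section \<open>Failure of weak and of uniform convergence\<close>

lemma not_weakly_converges:
  assumes "1 < nv"
  shows "\<not> weakly_converges (\<lambda>n. Tw ^^ n) L"
proof
  assume "weakly_converges (\<lambda>n. Tw ^^ n) L"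
  obtain z where z: "z \<in> ball 0 1" "1 < cmod (v z)"
    using less_H_inf_norm_D[OF assms] by blast
  have "(\<lambda>n. hardy2_fun ((Tw ^^ n) (hmonom 0)) z) \<longlonglongrightarrow> hardy2_fun (L (hmonom 0)) z"
    by (rule weakly_convergesD[OF \<open>weakly_converges _ L\<close> point_evaluation_dual[OF z(1)]])
  from LIMSEQ_subseq_LIMSEQ[OF this subseq_mult_k]
  have "(\<lambda>n. v z ^ n) \<longlonglongrightarrow> hardy2_fun (L (hmonom 0)) z"
    by (simp add: o_def hardy2_fun_T_pow_one[OF z(1)])
  \<comment> \<open>Convergence would make the powers of \<open>v z\<close> bounded, although
    \<open>|v z| > 1\<close>.\<close>
  then have "Bseq (\<lambda>n. v z ^ n)"
    using convergentI convergent_imp_Bseq by blast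
  then obtain K where K: "\<And>n. cmod (v z) ^ n \<le> K"
    unfolding Bseq_def by (auto simp: norm_power)
  obtain n where "K < cmod (v z) ^ n"
    using real_arch_pow[OF z(2)] by blast
  with K[of n] show False
    by simp
qed

lemma uniformly_imp_strongly:
  assumes U: "uniformly_converges (\<lambda>n. Tw ^^ n) L"
  shows "strongly_converges (\<lambda>n. Tw ^^ n) L"
  unfolding strongly_converges_def
proof
  fix f
  have L: "bounded_linear L" "(\<lambda>n. onorm (\<lambda>f. (Tw ^^ n) f - L f)) \<longlonglongrightarrow> 0"
    using U by (auto simp: uniformly_converges_def)
  have "(\<lambda>n. (Tw ^^ n) f - L f) \<longlonglongrightarrow> 0"
  proof (rule Lim_null_comparison)
    show "\<forall>\<^sub>F n in sequentially. norm ((Tw ^^ n) f - L f) \<le> onorm (\<lambda>f. (Tw ^^ n) f - L f) * norm f"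
      by (intro always_eventually allI onorm bounded_linear_sub bounded_linear_T_pow L)
    show "(\<lambda>n. onorm (\<lambda>f. (Tw ^^ n) f - L f) * norm f) \<longlonglongrightarrow> 0"
      using tendsto_mult_right[OF L(2), of "norm f"] by simp
  qed
  then show "(\<lambda>n. (Tw ^^ n) f) \<longlonglongrightarrow> L f"
    by (simp add: LIM_zero_iff)
qed

text \<open>If \<open>T ^^ (k * n)\<close> had norm below \<open>1/2\<close>, then applying its iterates to the constant function \<open>1\<close>
  and evaluating at \<open>z\<close> would give \<open>cmod (v z) ^ n \<le> 1/2\<close> for all \<open>z\<close>.\<close>

lemma onorm_T_pow_not_tendsto_0:
  assumes q1: "nv = 1"
  shows "\<not> (\<lambda>n. onorm (Tw ^^ n)) \<longlonglongrightarrow> 0"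
proof
  assume "(\<lambda>n. onorm (Tw ^^ n)) \<longlonglongrightarrow> 0"
  from LIMSEQ_subseq_LIMSEQ[OF this subseq_mult_k]
  have "\<forall>\<^sub>F n in sequentially. onorm (Tw ^^ (k * n)) < 1 / 2"
    by (intro order_tendstoD(2)[where y = 0]) (auto simp: o_def)
  from eventually_conj[OF this eventually_gt_at_top[of 0]]
  have "\<exists>n. onorm (Tw ^^ (k * n)) < 1 / 2 \<and> 0 < n"
    by (rule eventually_happens'[OF sequentially_bot])
  then obtain n where n: "onorm (Tw ^^ (k * n)) < 1 / 2" "0 < n"
    by blast
  let ?S = "Tw ^^ (k * n)"
  have S: "norm (?S f) \<le> (1 / 2) * norm f" for f
    by (rule order_trans[OF onorm[OF bounded_linear_T_pow] mult_right_mono[OF less_imp_le[OF n(1)] norm_ge_zero]])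
  have Sm: "norm ((?S ^^ m) f) \<le> (1 / 2) ^ m * norm f" for m f
  proof (induction m)
    case (Suc m)
    have "norm ((?S ^^ Suc m) f) \<le> (1 / 2) * norm ((?S ^^ m) f)"
      using S by simp
    with Suc show ?case
      by simp
  qed simp
  \<comment> \<open>The root is below 1, so there is a point \<open>z\<close> with
    \<open>|v z|^n > 1/2\<close>. The exponent \<open>m\<close> is then taken large enough to beat
    the constant of the point evaluation.\<close>
  have "root n (1 / 2) < nv"
    using n(2) q1 by simp
  then obtain z where z: "z \<in> ball 0 1" "root n (1 / 2) < cmod (v z)"
    by (rule less_H_inf_norm_D)
  have z1: "0 < 1 - cmod z"
    using z by simp
  have "root n (1 / 2) ^ n < cmod (v z) ^ n"
    using z(2) n(2) by (intro power_strict_mono) auto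
  then have "1 < 2 * cmod (v z) ^ n"
    using n(2) by simp
  then obtain m where m: "norm (hmonom 0) / (1 - cmod z) < (2 * cmod (v z) ^ n) ^ m"
    using real_arch_pow by blast
  have "(cmod (v z) ^ n) ^ m = cmod (hardy2_fun ((Tw ^^ (k * (n * m))) (hmonom 0)) z)"
    by (simp add: hardy2_fun_T_pow_one[OF z(1)] norm_power power_mult)
  also have "\<dots> \<le> norm ((Tw ^^ (k * (n * m))) (hmonom 0)) / (1 - cmod z)"
    by (rule cmod_hardy2_le[OF z(1)])
  also have "Tw ^^ (k * (n * m)) = ?S ^^ m"
    by (simp add: funpow_mult mult_ac)
  also have "norm ((?S ^^ m) (hmonom 0)) / (1 - cmod z) \<le> (1 / 2) ^ m * norm (hmonom 0) / (1 - cmod z)"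
    using z1 by (intro divide_right_mono Sm) auto
  finally have "(2 * cmod (v z) ^ n) ^ m \<le> norm (hmonom 0) / (1 - cmod z)"
    using z1 by (simp add: power_mult_distrib field_simps)
  with m show False
    by simp
qed

section \<open>Weak and strong convergence to 0 when the sup norm of v is 1\<close>

lemma power_bounded:
  assumes "nv = 1"
  shows "norm ((Tw ^^ n) f) \<le> bnd * norm f"
  using norm_T_pow_le[of n f] assms by simp

lemma cmod_v_less_1:
  assumes q1: "nv = 1" and nc: "\<not> v constant_on ball 0 1" and z: "z \<in> ball 0 1"
  shows "cmod (v z) < 1"
proof (rule ccontr)
  assume "\<not> cmod (v z) < 1"
  then have "cmod (v y) \<le> cmod (v z)" if "y \<in> ball 0 1" for y
    using cmod_v_le[OF that] q1 by simp
  then have "v constant_on ball 0 1"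
    using maximum_modulus_principle[OF v_holo, of "ball 0 1" z] z by auto
  with nc show False
    by simp
qed

text \<open>On the circle of radius 1/2 compactness yields a uniform bound \<open>p < 1\<close> for
  \<open>|v|\<close>. There \<open>(Tw ^^ n) f\<close> is at most a constant times
  \<open>p ^ (n div k)\<close>, so Cauchy's estimates make each Taylor coefficient tend to 0, and
  power boundedness turns this into weak convergence.\<close>

lemma weakly_converges_0:
  assumes q1: "nv = 1" and nc: "\<not> v constant_on ball 0 1"
  shows "weakly_converges (\<lambda>n. Tw ^^ n) (\<lambda>f. 0)"
  unfolding weakly_converges_def
proof (intro allI ballI)
  fix f \<psi> assume \<psi>: "\<psi> \<in> hardy2_dual"
  have "continuous_on (sphere 0 (1/2)) (\<lambda>z. cmod (v z))"
    by (intro continuous_intros continuous_on_subset[OF holomorphic_on_imp_continuous_on[OF v_holo]]) auto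
  moreover have "sphere 0 (1/2) \<noteq> ({} :: complex set)"
    by simp
  ultimately obtain x where x: "x \<in> sphere 0 (1/2)" "\<And>y. y \<in> sphere 0 (1/2) \<Longrightarrow> cmod (v y) \<le> cmod (v x)"
    using continuous_attains_sup[OF compact_sphere] by blast
  define p where "p = cmod (v x)"
  have "p < 1" "0 \<le> p"
    unfolding p_def using x(1) by (auto intro!: cmod_v_less_1[OF q1 nc])
  have coeff: "(\<lambda>n. taylor_coeff (hardy2_fun ((Tw ^^ n) f)) i) \<longlonglongrightarrow> 0" for i
  proof (rule Lim_null_comparison)
    show "\<forall>\<^sub>F n in sequentially. norm (taylor_coeff (hardy2_fun ((Tw ^^ n) f)) i) \<le>
        p ^ (n div k) * (2 * bnd * norm f) * 2 ^ i"
    proof (intro always_eventually allI)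
      fix n
      let ?g = "hardy2_fun ((Tw ^^ n) f)"
      have g: "?g holomorphic_on ball 0 1"
        by (intro H2_holo hardy2_fun_H2)
      have "cmod ((deriv ^^ i) ?g 0) \<le> fact i * (p ^ (n div k) * (2 * bnd * norm f)) / (1/2) ^ i"
      proof (rule Cauchy_inequality)
        show "?g holomorphic_on ball 0 (1/2)"
          by (rule holomorphic_on_subset[OF g]) auto
        show "continuous_on (cball 0 (1/2)) ?g"
          by (rule continuous_on_subset[OF holomorphic_on_imp_continuous_on[OF g]]) auto
        fix z :: complex assume "cmod (0 - z) = 1/2"
        then have z: "cmod z = 1/2" "z \<in> ball 0 1" "z \<in> sphere 0 (1/2)"
          by auto
        let ?f = "(Tw ^^ (n mod k)) f"
        have "cmod (?g z) = cmod (v z) ^ (n div k) * cmod (hardy2_fun ?f z)"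
          unfolding T_pow_split[of n] hardy2_fun_T_pow_mult[OF z(2)] by (simp add: norm_mult norm_power)
        also have "\<dots> \<le> p ^ (n div k) * (norm ?f / (1 - cmod z))"
          unfolding p_def by (intro mult_mono power_mono x z cmod_hardy2_le) auto
        \<comment> \<open>Point evaluation at radius 1/2 costs the factor
          \<open>1 / (1 - 1/2) = 2\<close>.\<close>
        also have "\<dots> = p ^ (n div k) * (2 * norm ?f)"
          unfolding z(1) by simp
        also have "\<dots> \<le> p ^ (n div k) * (2 * (bnd * norm f))"
          using \<open>0 \<le> p\<close> k_pos by (intro mult_left_mono norm_T_pow_le_B) (auto simp: less_imp_le)
        finally show "cmod (?g z) \<le> p ^ (n div k) * (2 * bnd * norm f)"
          by simp
      qed simp
      then show "norm (taylor_coeff ?g i) \<le> p ^ (n div k) * (2 * bnd * norm f) * 2 ^ i"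
        by (simp add: taylor_coeff_def norm_divide power_divide field_simps)
    qed
    have "(\<lambda>n. p ^ n) \<longlonglongrightarrow> 0"
      using \<open>p < 1\<close> \<open>0 \<le> p\<close> by (intro LIMSEQ_realpow_zero) auto
    from filterlim_compose[OF this filterlim_div_k]
    have "(\<lambda>n. p ^ (n div k) * (2 * bnd * norm f) * 2 ^ i) \<longlonglongrightarrow> 0 * (2 * bnd * norm f) * 2 ^ i"
      by (intro tendsto_intros)
    then show "(\<lambda>n. p ^ (n div k) * (2 * bnd * norm f) * 2 ^ i) \<longlonglongrightarrow> 0"
      by simp
  qed
  have "(\<lambda>n. \<psi> ((Tw ^^ n) f)) \<longlonglongrightarrow> 0"
    by (rule dual_tendsto_0[OF \<psi> power_bounded[OF q1] coeff])
  moreover have "\<psi> 0 = 0"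
    using \<psi> bounded_linear.linear linear_0 by (auto simp: hardy2_dual_def)
  ultimately show "(\<lambda>n. \<psi> ((Tw ^^ n) f)) \<longlonglongrightarrow> \<psi> 0"
    by simp
qed

text \<open>The splitting of \<open>T_pow_split\<close> in the other order: the remainder is applied
  last, so smallness along multiples of \<open>k\<close> carries over to all exponents.\<close>

lemma norm_T_pow_le_mult: "norm ((Tw ^^ n) f) \<le> bnd * norm ((Tw ^^ (k * (n div k))) f)"
proof -
  have "(Tw ^^ n) f = (Tw ^^ (n mod k)) ((Tw ^^ (k * (n div k))) f)"
    using funpow_add[of "n mod k" "k * (n div k)" Tw] by (simp add: mod_mult_div_eq)
  then show ?thesis
    using norm_T_pow_le_B[of "n mod k"] k_pos by (simp add: less_imp_le)
qed

text \<open>Along multiples of \<open>k\<close> the operators do not increase norms, so it suffices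
  to treat Taylor polynomials. Such a polynomial is bounded on the disc by the sum \<open>C\<close>
  of the moduli of its coefficients, and its image has norm at most \<open>C\<close> times that of
  \<open>v ^ m\<close>.\<close>

lemma strongly_converges_0:
  assumes q1: "nv = 1" and v0: "(\<lambda>n. H2_norm (\<lambda>z. v z ^ n)) \<longlonglongrightarrow> 0"
  shows "strongly_converges (\<lambda>n. Tw ^^ n) (\<lambda>f. 0)"
  unfolding strongly_converges_def
proof
  fix f
  let ?p = "taylor_poly (hardy2_fun f)"
  have lim: "(\<lambda>m. norm ((Tw ^^ (k * m)) f)) \<longlonglongrightarrow> 0"
  proof (rule LIMSEQ_I)
    fix e :: real assume e: "0 < e"
    have "\<forall>\<^sub>F N in sequentially. H2_norm (\<lambda>z. hardy2_fun f z - ?p N z) < e / 2"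
      by (rule order_tendstoD(2)[OF H2_norm_minus_taylor_poly_tendsto_0[OF hardy2_fun_H2]]) (use e in simp)
    from eventually_happens'[OF sequentially_bot this]
    obtain N where N: "H2_norm (\<lambda>z. hardy2_fun f z - ?p N z) < e / 2"
      by blast
    define g where "g = to_hardy2 (?p N)"
    define C where "C = (\<Sum>n<N. cmod (taylor_coeff (hardy2_fun f) n))"
    have g: "hardy2_fun g z = ?p N z" if "z \<in> ball 0 1" for z
      unfolding g_def by (rule hardy2_fun_to_hardy2[OF H2_taylor_poly that])
    have fg: "norm (f - g) < e / 2"
    proof -
      have "norm (f - g) = H2_norm (\<lambda>z. hardy2_fun f z - ?p N z)"
        unfolding norm_hardy2_def by (rule H2_norm_cong) (simp only: hardy2_fun_diff g)
      with N show ?thesis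
        by simp
    qed
    have pC: "cmod (?p N z) \<le> C" if z: "z \<in> ball 0 1" for z
    proof -
      have "cmod (taylor_coeff (hardy2_fun f) n * z ^ n) \<le> cmod (taylor_coeff (hardy2_fun f) n)" for n
        using z by (simp add: norm_mult norm_power mult_left_le power_le_one)
      then show ?thesis
        unfolding taylor_poly_def C_def by (intro order_trans[OF norm_sum] sum_mono)
    qed
    have vH2: "(\<lambda>z. v z ^ m) \<in> H2" for m
      by (rule unit_ball_power_H2[OF v_holo]) (use cmod_v_le q1 in simp)
    have C0: "0 \<le> C"
      unfolding C_def by (intro sum_nonneg) simp
    have Tg: "norm ((Tw ^^ (k * m)) g) \<le> C * H2_norm (\<lambda>z. v z ^ m)" for m
    proof -
      have "norm ((Tw ^^ (k * m)) g) = H2_norm (\<lambda>z. ?p N z * v z ^ m)"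
        unfolding norm_hardy2_def by (rule H2_norm_cong) (simp only: hardy2_fun_T_pow_mult g mult.commute)
      also have "\<dots> \<le> C * H2_norm (\<lambda>z. v z ^ m)"
      proof (rule H2_norm_le)
        fix r :: real assume r: "0 \<le> r" "r < 1"
        have "sq_mean (\<lambda>z. ?p N z * v z ^ m) r \<le> C\<^sup>2 * sq_mean (\<lambda>z. v z ^ m) r"
          by (rule sq_mean_mult_le[OF H2_holo[OF H2_taylor_poly] pC H2_holo[OF vH2] r])
        also have "\<dots> \<le> C\<^sup>2 * (H2_norm (\<lambda>z. v z ^ m))\<^sup>2"
          by (intro mult_left_mono sq_mean_le_H2_norm vH2 r) simp
        finally show "sq_mean (\<lambda>z. ?p N z * v z ^ m) r \<le> (C * H2_norm (\<lambda>z. v z ^ m))\<^sup>2"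
          by (simp add: power_mult_distrib)
      qed (simp add: C0 H2_norm_nonneg vH2)
      finally show ?thesis .
    qed
    have "(\<lambda>m. C * H2_norm (\<lambda>z. v z ^ m)) \<longlonglongrightarrow> C * 0"
      by (intro tendsto_intros v0)
    then have "\<forall>\<^sub>F m in sequentially. C * H2_norm (\<lambda>z. v z ^ m) < e / 2"
      using e by (intro order_tendstoD(2)[where y = "C * 0"]) auto
    then obtain m0 where m0: "\<And>m. m \<ge> m0 \<Longrightarrow> C * H2_norm (\<lambda>z. v z ^ m) < e / 2"
      unfolding eventually_sequentially by blast
    have "norm ((Tw ^^ (k * m)) f) < e" if "m \<ge> m0" for m
    proof -
      have "(Tw ^^ (k * m)) f = (Tw ^^ (k * m)) (f - g) + (Tw ^^ (k * m)) g"
        using linear_add[OF bounded_linear.linear[OF bounded_linear_T_pow], of "k * m" "f - g" g] by simp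
      then have "norm ((Tw ^^ (k * m)) f) \<le> norm ((Tw ^^ (k * m)) (f - g)) + norm ((Tw ^^ (k * m)) g)"
        by (metis norm_triangle_ineq)
      also have "norm ((Tw ^^ (k * m)) (f - g)) \<le> norm (f - g)"
        using norm_T_pow_mult_le[of m "f - g"] q1 by simp
      finally show ?thesis
        using fg Tg[of m] m0[OF that] by linarith
    qed
    then show "\<exists>m0. \<forall>m\<ge>m0. norm (norm ((Tw ^^ (k * m)) f) - 0) < e"
      by auto
  qed
  show "(\<lambda>n. (Tw ^^ n) f) \<longlonglongrightarrow> 0"
  proof (rule Lim_null_comparison)
    show "\<forall>\<^sub>F n in sequentially. norm ((Tw ^^ n) f) \<le> bnd * norm ((Tw ^^ (k * (n div k))) f)"
      by (intro always_eventually allI norm_T_pow_le_mult)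
    have "(\<lambda>n. bnd * norm ((Tw ^^ (k * (n div k))) f)) \<longlonglongrightarrow> bnd * 0"
      by (intro tendsto_intros filterlim_compose[OF lim filterlim_div_k])
    then show "(\<lambda>n. bnd * norm ((Tw ^^ (k * (n div k))) f)) \<longlonglongrightarrow> 0"
      by simp
  qed
qed

text \<open>The constant function 1 is mapped by \<open>Tw ^^ (k * n)\<close> to
  \<open>v ^ n\<close>, so its orbit along multiples of \<open>k\<close> has these norms.\<close>

lemma H2_norm_power_tendsto_0_if_strongly_0:
  assumes "strongly_converges (\<lambda>n. Tw ^^ n) (\<lambda>f. 0)"
  shows "(\<lambda>n. H2_norm (\<lambda>z. v z ^ n)) \<longlonglongrightarrow> 0"
proof -
  have "(\<lambda>n. (Tw ^^ n) (hmonom 0)) \<longlonglongrightarrow> 0"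
    using assms by (simp add: strongly_converges_def)
  from tendsto_norm_zero[OF LIMSEQ_subseq_LIMSEQ[OF this subseq_mult_k]]
  show ?thesis
    by (simp add: o_def norm_T_pow_one)
qed

text \<open>A uniform limit is also a strong and a weak limit, so it can only be 0, and then the
  operator norms would tend to 0.\<close>

lemma not_uniformly_converges:
  assumes q1: "nv = 1" and s: "strongly_converges (\<lambda>n. Tw ^^ n) (\<lambda>f. 0)"
  shows "\<not> uniformly_converges (\<lambda>n. Tw ^^ n) L"
proof
  assume U: "uniformly_converges (\<lambda>n. Tw ^^ n) L"
  have "L = (\<lambda>f. 0)"
    by (rule weak_limit_unique[OF strongly_imp_weakly[OF uniformly_imp_strongly[OF U]] strongly_imp_weakly[OF s]])
  with U have "(\<lambda>n. onorm (Tw ^^ n)) \<longlonglongrightarrow> 0"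
    by (simp add: uniformly_converges_def)
  with onorm_T_pow_not_tendsto_0[OF q1] show False
    by blast
qed

end

theorem theorem3p1:
  fixes w v :: "complex \<Rightarrow> complex" and \<mu> :: complex and k :: nat
    and T :: "hardy2 \<Rightarrow> hardy2"
  assumes w: "w \<in> H_inf"
    and mu: "primitive_root_of_unity k \<mu>"
    and v: "\<And>z. z \<in> ball 0 1 \<Longrightarrow> v z = (\<Prod>j<k. w (\<mu> ^ j * z))"
    and T: "T = wcomp w (\<lambda>z. \<mu> * z)"
  shows
    "(H_inf_norm v < 1 \<longrightarrow> (\<lambda>n. onorm (T ^^ n)) \<longlonglongrightarrow> 0) \<and>
     (H_inf_norm v > 1 \<longrightarrow> \<not> (\<exists>L. weakly_converges (\<lambda>n. T ^^ n) L)) \<and>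
     (H_inf_norm v = 1 \<and> \<not> v constant_on ball 0 1 \<longrightarrow>
       ((AE t in lebesgue_on {0..2*pi}. cmod (boundary_value v (cis t)) < 1) \<longrightarrow>
          strongly_converges (\<lambda>n. T ^^ n) (\<lambda>f. 0) \<and>
          \<not> (\<exists>L. uniformly_converges (\<lambda>n. T ^^ n) L)) \<and>
       ((\<exists>E\<in>sets lebesgue. E \<subseteq> {0..2*pi} \<and> measure lebesgue E > 0 \<and>
            (\<forall>t\<in>E. cmod (boundary_value v (cis t)) = 1)) \<longrightarrow>
          \<not> (\<lambda>n. H2_norm (\<lambda>z. v z ^ n)) \<longlonglongrightarrow> 0 \<and>
          weakly_converges (\<lambda>n. T ^^ n) (\<lambda>f. 0) \<and>
          \<not> (\<exists>L. strongly_converges (\<lambda>n. T ^^ n) L)))"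
proof -
  interpret R: rotation_weight w v \<mu> k
    by unfold_locales (fact w, fact mu, fact v)
  have a: "strongly_converges (\<lambda>n. T ^^ n) (\<lambda>f. 0) \<and> \<not> (\<exists>L. uniformly_converges (\<lambda>n. T ^^ n) L)"
    if q1: "H_inf_norm v = 1"
      and ae: "AE t in lebesgue_on {0..2*pi}. cmod (boundary_value v (cis t)) < 1"
  proof -
    have "(\<lambda>n. H2_norm (\<lambda>z. v z ^ n)) \<longlonglongrightarrow> 0"
      by (rule H2_norm_power_tendsto_0[OF R.v_holo _ ae]) (use R.cmod_v_le q1 in simp)
    then have "strongly_converges (\<lambda>n. T ^^ n) (\<lambda>f. 0)"
      unfolding T by (rule R.strongly_converges_0[OF q1])
    then show ?thesis
      using R.not_uniformly_converges[OF q1] unfolding T by blast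
  qed
  have b: "\<not> (\<lambda>n. H2_norm (\<lambda>z. v z ^ n)) \<longlonglongrightarrow> 0 \<and> weakly_converges (\<lambda>n. T ^^ n) (\<lambda>f. 0) \<and>
      \<not> (\<exists>L. strongly_converges (\<lambda>n. T ^^ n) L)"
    if q1: "H_inf_norm v = 1" and nc: "\<not> v constant_on ball 0 1"
      and E: "E \<in> sets lebesgue" "E \<subseteq> {0..2*pi}" "measure lebesgue E > 0"
      and bE: "\<And>t. t \<in> E \<Longrightarrow> cmod (boundary_value v (cis t)) = 1" for E
  proof (intro conjI notI)
    have lower: "measure lebesgue E / (2*pi) \<le> (H2_norm (\<lambda>z. v z ^ n))\<^sup>2" for n
      by (rule H2_norm_power_lower_bound[OF R.v_holo _ E(1,2) bE]) (use R.cmod_v_le q1 in simp)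
    have no: False if "(\<lambda>n. H2_norm (\<lambda>z. v z ^ n)) \<longlonglongrightarrow> 0"
    proof -
      have "(\<lambda>n. (H2_norm (\<lambda>z. v z ^ n))\<^sup>2) \<longlonglongrightarrow> 0\<^sup>2"
        by (intro tendsto_intros that)
      then have "measure lebesgue E / (2*pi) \<le> 0\<^sup>2"
        by (rule LIMSEQ_le_const) (use lower in blast)
      moreover have "0 < measure lebesgue E / (2*pi)"
        using E(3) by simp
      ultimately show False
        by simp
    qed
    show wk: "weakly_converges (\<lambda>n. T ^^ n) (\<lambda>f. 0)"
      unfolding T by (rule R.weakly_converges_0[OF q1 nc])
    show False if "(\<lambda>n. H2_norm (\<lambda>z. v z ^ n)) \<longlonglongrightarrow> 0"
      using no that .
    show False if ex: "\<exists>L. strongly_converges (\<lambda>n. T ^^ n) L"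
    proof -
      obtain L where L: "strongly_converges (\<lambda>n. T ^^ n) L"
        using ex by blast
      \<comment> \<open>A strong limit is also a weak limit, so it must be 0; strong convergence to
        0 would force the norms of \<open>v ^ n\<close> to tend to 0.\<close>
      have "L = (\<lambda>f. 0)"
        by (rule weak_limit_unique[OF strongly_imp_weakly[OF L] wk])
      with L show False
        using no R.H2_norm_power_tendsto_0_if_strongly_0 unfolding T by blast
    qed
  qed
  show ?thesis
    using R.onorm_T_pow_tendsto_0 R.not_weakly_converges a b unfolding T[symmetric] by blast
qed

end
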